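(* Let $f:[0,1]\to(0,1)$ be a $C^3$ function whose fixed points are isolated, and assume $f\ge 1/2$ on $[0,1]$. Let $w_0=(\alpha_0^x,l_0^x)_{x\in\mathbb{Z}}\in([0,1]\times(0,+\infty))^{\mathbb{Z}}$ be an initial environment such that $w_0^x=w_0^1$ for all $x\ge 1$. Let $X$ be the generalized reinforced random walk associated to $f$ with law $\mathbb{P}_{0,w_0}$. Then $X$ is almost surely recurrent if and only if $\mathbb{E}[\delta^1_\infty]\le 1$.
   Context: Urn process associated to $f$: a Markov chain $((\alpha_n,l_n),n\ge 0)$ on $[0,1]\times(0,+\infty)$ with $l_{n+1}=l_n+1$, and $\alpha_{n+1}=(l_n\alpha_n+1)/(l_n+1)$ with probability $f(\alpha_n)$, $\alpha_{n+1}=l_n\alpha_n/(l_n+1)$ with probability $1-f(\alpha_n)$. Generalized reinforced random walk started at $(0,w_0)$ associated to $f$: $X_0=0$; for $x\in\mathbb{Z}$, $n\ge0$ let $L_n^x=\sum_{k=0}^{n-1}1_{\{X_k=x\}}$ and $\tilde\alpha_n^x=\frac{1}{l_0^x+L_n^x}\big(\alpha_0^xl_0^x+\sum_{k=0}^{n-1}1_{\{X_k=x,X_{k+1}=x+1\}}\big)$; given the past, if $X_n=x$ then $X_{n+1}=x+1$ with probability $f(\tilde\alpha_n^x)$ and $X_{n+1}=x-1$ otherwise. Its law is denoted $\mathbb{P}_{0,w_0}$ (and $\mathbb{P}_{k,w_0}$ when started at $k$). The walk is recurrent if it visits every site infinitely often. $\delta^1_\infty:=\sum_{k\ge 0}(2f(\alpha_k)-1)$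 where $(\alpha_k,l_k)_{k\ge0}$ is an urn process associated to $f$ started from $(\alpha_0,l_0)=w_0^1$; $\mathbb{E}$ denotes expectation for this urn process. *)

theory Defs
  imports "HOL-Probability.Probability"
begin

text \<open>Randomness source: an i.i.d. sequence of uniform [0,1] variables.
  Both processes are realised by the standard coupling: step "up" at time n
  iff U n < (probability of going up).\<close>

definition unif_seq :: "(nat \<Rightarrow> real) measure" where
  "unif_seq = PiM UNIV (\<lambda>_. uniform_measure lborel {0..1::real})"

definition C3_on_unit :: "(real \<Rightarrow> real) \<Rightarrow> bool" where
  "C3_on_unit f \<longleftrightarrow> (\<exists>f1 f2 f3.
      (\<forall>x\<in>{0..1}. (f has_real_derivative f1 x) (at x within {0..1})) \<and>
      (\<forall>x\<in>{0..1}. (f1 has_real_derivative f2 x) (at x within {0..1})) \<and>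
      (\<forall>x\<in>{0..1}. (f2 has_real_derivative f3 x) (at x within {0..1})) \<and>
      continuous_on {0..1} f3)"

definition isolated_fixed_points :: "(real \<Rightarrow> real) \<Rightarrow> bool" where
  "isolated_fixed_points f \<longleftrightarrow> (\<forall>x\<in>{0..1}. f x = x \<longrightarrow>
      (\<exists>e>0. \<forall>y\<in>{0..1}. f y = y \<and> \<bar>y - x\<bar> < e \<longrightarrow> y = x))"

primrec urn_alpha :: "(real \<Rightarrow> real) \<Rightarrow> real \<Rightarrow> real \<Rightarrow> (nat \<Rightarrow> real) \<Rightarrow> nat \<Rightarrow> real" where
  "urn_alpha f a0 l0 U 0 = a0"
| "urn_alpha f a0 l0 U (Suc k) =
     (let a = urn_alpha f a0 l0 U k; l = l0 + real k in
      if U k < f a then (l * a + 1) / (l + 1) else l * a / (l + 1))"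

text \<open>Reinforced environment at site x given the path xs = [X_0,...,X_n]
  (n = length xs - 1).\<close>
definition env_alpha :: "(int \<Rightarrow> real) \<Rightarrow> (int \<Rightarrow> real) \<Rightarrow> int list \<Rightarrow> int \<Rightarrow> real" where
  "env_alpha a0 l0 xs x =
     (let n = length xs - 1;
          L = card {k. k < n \<and> xs ! k = x};
          U = card {k. k < n \<and> xs ! k = x \<and> xs ! Suc k = x + 1}
      in (a0 x * l0 x + real U) / (l0 x + real L))"

primrec grrw_path :: "(real \<Rightarrow> real) \<Rightarrow> (int \<Rightarrow> real) \<Rightarrow> (int \<Rightarrow> real) \<Rightarrow> (nat \<Rightarrow> real) \<Rightarrow> nat \<Rightarrow> int list" where
  "grrw_path f a0 l0 U 0 = [0]"
| "grrw_path f a0 l0 U (Suc n) =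
     (let xs = grrw_path f a0 l0 U n; x = last xs in
      xs @ [if U n < f (env_alpha a0 l0 xs x) then x + 1 else x - 1])"

definition grrw :: "(real \<Rightarrow> real) \<Rightarrow> (int \<Rightarrow> real) \<Rightarrow> (int \<Rightarrow> real) \<Rightarrow> (nat \<Rightarrow> real) \<Rightarrow> nat \<Rightarrow> int" where
  "grrw f a0 l0 U n = last (grrw_path f a0 l0 U n)"

definition recurrent_path :: "(nat \<Rightarrow> int) \<Rightarrow> bool" where
  "recurrent_path X \<longleftrightarrow> (\<forall>x::int. infinite {n. X n = x})"

end

theory Submission
  imports Defs
begin

text \<open>
  Give every site its own independent urn, read as a stack of arrows; the walk that follows the
  arrows has the law of the reinforced walk. Let \<open>T\<^sub>k\<close> be the first hitting time of \<open>k\<close>. The number of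
  steps from \<open>x + 1\<close> to \<open>x\<close> before \<open>T\<^sub>k\<close> is a function of the stacks strictly between \<open>x\<close> and \<open>k\<close>
  only, and its law depends on \<open>k - x\<close> only. On the other hand the walk minus its accumulated drift
  is a martingale.

  If the walk is recurrent, then stopping at \<open>T\<^sub>k\<close> bounds the expected drift consumed at the sites
  \<open>1, \<dots>, k - 1\<close> by \<open>k\<close>, whereas most of these sites are visited more than \<open>N\<close> times before \<open>T\<^sub>k\<close>;
  averaging over the sites shows that the mean drift of the first \<open>N\<close> arrows of a stack is at most 1.

  If the walk is not recurrent, then with probability \<open>p > 0\<close> a walk arriving at a fresh half-line
  never leaves it. Stop the walk when, after time 0, it first leaves the sites strictly between 0
  and \<open>k\<close>, and let \<open>b\<^sub>k\<close> be the probability that it does so at \<open>k\<close>. The martingale gives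
  \<open>k b\<^sub>k \<le> 2 + (g - h p) (b\<^sub>1 + \<dots> + b\<^sub>k\<^sub>-\<^sub>1)\<close>, where \<open>g\<close> is the mean total drift of a stack and \<open>h\<close> the
  mean drift left in a stack whose first arrow is up after that arrow has been used. Since \<open>b\<^sub>k\<close>
  decreases to a positive limit, \<open>g - h p \<ge> 1\<close>. Moreover \<open>h > 0\<close> unless \<open>g = 0\<close>, because the
  compositions an urn can reach after a first up arrow are dense, so \<open>g > 1\<close>.
\<close>

section \<open>Counting and averaging\<close>

definition count_below :: "(nat \<Rightarrow> bool) \<Rightarrow> nat \<Rightarrow> nat" where
  "count_below P n = card {k. k < n \<and> P k}"

lemma count_below_0 [simp]: "count_below P 0 = 0"
  by (simp add: count_below_def)

lemma count_below_Suc: "count_below P (Suc n) = count_below P n + (if P n then 1 else 0)"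
proof -
  have "{k. k < Suc n \<and> P k} = (if P n then insert n {k. k < n \<and> P k} else {k. k < n \<and> P k})"
    by (auto simp: less_Suc_eq)
  then show ?thesis by (simp add: count_below_def)
qed

lemma count_below_mono: "m \<le> n \<Longrightarrow> count_below P m \<le> count_below P n"
  unfolding count_below_def by (intro card_mono) auto

lemma count_below_cong: "(\<And>k. k < n \<Longrightarrow> P k = Q k) \<Longrightarrow> count_below P n = count_below Q n"
  by (auto simp: count_below_def intro!: arg_cong[where f = card])

lemma count_below_le: "count_below P n \<le> n"
  by (induction n) (auto simp: count_below_Suc)

lemma count_below_less_eq_min: "count_below (\<lambda>k. k < m) n = min m n"
  by (induction n) (auto simp: count_below_Suc)

lemma infinite_iff_count_below_unbounded:
  "infinite {k. P k} \<longleftrightarrow> (\<forall>N. \<exists>n. N \<le> count_below P n)"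
proof
  assume inf: "infinite {k. P k}"
  show "\<forall>N. \<exists>n. N \<le> count_below P n"
  proof
    fix N
    obtain B where B_props: "finite B" "card B = N" "B \<subseteq> {k. P k}"
      using infinite_arbitrarily_large[OF inf] by blast
    then obtain n where "\<forall>k\<in>B. k < n"
      using finite_nat_set_iff_bounded by blast
    then have "B \<subseteq> {k. k < n \<and> P k}"
      using B_props by auto
    then show "\<exists>n. N \<le> count_below P n"
      using B_props(2) card_mono[of "{k. k < n \<and> P k}" B] by (auto simp: count_below_def)
  qed
next
  assume unbounded: "\<forall>N. \<exists>n. N \<le> count_below P n"
  show "infinite {k. P k}"
  proof
    assume "finite {k. P k}"
    then have "count_below P n \<le> card {k. P k}" for n
      unfolding count_below_def by (intro card_mono) auto
    moreover obtain n where "Suc (card {k. P k}) \<le> count_below P n"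
      using unbounded by blast
    ultimately show False
      using not_less_eq_eq by blast
  qed
qed

lemma cesaro_mean_tendsto:
  fixes r :: "nat \<Rightarrow> 'a::real_normed_field"
  assumes "r \<longlonglongrightarrow> L"
  shows "(\<lambda>m. (\<Sum>j<m. r j) / of_nat m) \<longlonglongrightarrow> L"
proof (rule LIMSEQ_I)
  fix e :: real assume e_pos: "0 < e"
  obtain n0 where tail_close: "norm (r j - L) < e/2" if "j \<ge> n0" for j
    using LIMSEQ_D[OF assms, of "e/2"] e_pos by auto
  define C where "C = (\<Sum>j<n0. norm (r j - L))"
  obtain m0 :: nat where m0_large: "2 * C / e < real m0"
    using reals_Archimedean2 by blast
  have "norm ((\<Sum>j<m. r j) / of_nat m - L) < e" if m_large: "m \<ge> max (Suc m0) n0" for m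
  proof -
    have m_pos: "0 < m" "2 * C / e < real m"
      using m_large m0_large by auto
    have "norm (\<Sum>j<m. r j - L) \<le> (\<Sum>j<m. norm (r j - L))"
      by (rule norm_sum)
    also have "\<dots> = C + (\<Sum>j=n0..<m. norm (r j - L))"
      unfolding C_def using m_large by (simp add: lessThan_atLeast0 sum.atLeastLessThan_concat)
    also have "(\<Sum>j=n0..<m. norm (r j - L)) \<le> (\<Sum>j=n0..<m. e/2)"
      using tail_close by (intro sum_mono) (auto intro: less_imp_le)
    also have "\<dots> \<le> real m * (e/2)"
      using e_pos by simp
    also have "C < real m * (e/2)"
      using m_pos(2) e_pos by (simp add: field_simps)
    finally have "norm (\<Sum>j<m. r j - L) < e * real m"
      by (simp add: mult.commute)
    moreover have "(\<Sum>j<m. r j) / of_nat m - L = (\<Sum>j<m. r j - L) / of_nat m"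
      using m_pos(1) by (simp add: sum_subtractf field_simps)
    ultimately show ?thesis
      using m_pos(1) by (simp add: norm_divide divide_less_eq)
  qed
  then show "\<exists>no. \<forall>m\<ge>no. norm ((\<Sum>j<m. r j) / of_nat m - L) < e"
    by blast
qed

context finite_measure
begin

lemma nn_integral_of_bool:
  assumes [measurable]: "Measurable.pred M P"
  shows "(\<integral>\<^sup>+x. of_bool (P x) \<partial>M) = ennreal (measure M {x \<in> space M. P x})"
proof -
  have "(\<integral>\<^sup>+x. of_bool (P x) \<partial>M) = (\<integral>\<^sup>+x. indicator {x \<in> space M. P x} x \<partial>M)"
    by (intro nn_integral_cong) (simp add: indicator_def)
  then show ?thesis
    by (simp add: emeasure_eq_measure)
qed

lemma integrable_of_bool: "Measurable.pred M P \<Longrightarrow> integrable M (\<lambda>x. of_bool (P x) :: real)"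
  by (rule integrable_const_bound[where B = 1]) auto

lemma integral_of_bool:
  assumes [measurable]: "Measurable.pred M P"
  shows "(\<integral>x. of_bool (P x) \<partial>M) = measure M {x \<in> space M. P x}"
proof -
  have "(\<integral>x. of_bool (P x) \<partial>M) = (\<integral>x. indicator {x \<in> space M. P x} x \<partial>M :: real)"
    by (intro Bochner_Integration.integral_cong) (simp_all add: indicator_def)
  then show ?thesis by simp
qed

lemma measure_tendsto_if_AE_eventually:
  assumes [measurable]: "\<And>n. A n \<in> sets M" "B \<in> sets M"
    and eq: "AE x in M. \<forall>\<^sub>F n in sequentially. x \<in> A n \<longleftrightarrow> x \<in> B"
  shows "(\<lambda>n. measure M (A n)) \<longlonglongrightarrow> measure M B"
proof -
  have "(\<lambda>n. \<integral>x. indicator (A n) x \<partial>M) \<longlonglongrightarrow> (\<integral>x. indicator B x \<partial>M :: real)"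
  proof (rule integral_dominated_convergence[where w = "\<lambda>_. 1"])
    show "AE x in M. (\<lambda>n. indicator (A n) x) \<longlonglongrightarrow> (indicator B x :: real)"
      using eq
    proof eventually_elim
      case (elim x)
      then have "\<forall>\<^sub>F n in sequentially. indicator (A n) x = (indicator B x :: real)"
        by eventually_elim (simp add: indicator_def)
      then show ?case
        by (rule tendsto_eventually)
    qed
  qed (auto simp: indicator_def)
  then show ?thesis by simp
qed

end

section \<open>Independent uniform variables\<close>

abbreviation unif01 :: "real measure" where
  "unif01 \<equiv> uniform_measure lborel {0..1}"

definition iid_unif :: "('i \<Rightarrow> real) measure" where
  "iid_unif = PiM UNIV (\<lambda>_. unif01)"

definition depends_on :: "'i set \<Rightarrow> (('i \<Rightarrow> 'a) \<Rightarrow> 'b) \<Rightarrow> bool" where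
  "depends_on J F \<longleftrightarrow> (\<forall>V W. (\<forall>i\<in>J. V i = W i) \<longrightarrow> F V = F W)"

lemma depends_onI: "(\<And>V W. (\<And>i. i \<in> J \<Longrightarrow> V i = W i) \<Longrightarrow> F V = F W) \<Longrightarrow> depends_on J F"
  unfolding depends_on_def by blast

lemma depends_onD: "depends_on J F \<Longrightarrow> (\<And>i. i \<in> J \<Longrightarrow> V i = W i) \<Longrightarrow> F V = F W"
  unfolding depends_on_def by blast

lemma depends_on_mono: "depends_on J F \<Longrightarrow> J \<subseteq> K \<Longrightarrow> depends_on K F"
  unfolding depends_on_def by blast

lemma depends_on_compose: "depends_on J F \<Longrightarrow> depends_on J (\<lambda>V. h (F V))"
  unfolding depends_on_def by (intro allI impI arg_cong[where f = h]) simp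

lemma depends_on_compose2:
  "depends_on J F \<Longrightarrow> depends_on J G \<Longrightarrow> depends_on J (\<lambda>V. h (F V) (G V))"
  unfolding depends_on_def by (intro allI impI arg_cong2[where f = h]) simp_all

lemma prob_space_unif01: "prob_space unif01"
  by (rule prob_space_uniform_measure) auto

lemma prob_space_iid_unif: "prob_space iid_unif"
  unfolding iid_unif_def by (intro prob_space_PiM prob_space_unif01)

lemma unif_seq_eq_iid_unif: "unif_seq = iid_unif"
  by (simp add: unif_seq_def iid_unif_def)

interpretation iid_unif: prob_space "iid_unif :: ('i \<Rightarrow> real) measure"
  by (rule prob_space_iid_unif)

lemma space_iid_unif [simp]: "space iid_unif = UNIV"
  by (simp add: iid_unif_def space_PiM)

lemma prob_iid_unif_UNIV [simp]: "iid_unif.prob UNIV = 1"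
  using iid_unif.prob_space by simp

lemma sets_iid_unif_Collect [measurable (raw)]:
  "Measurable.pred iid_unif P \<Longrightarrow> {V. P V} \<in> sets iid_unif"
  by (simp add: pred_def)

lemma measurable_unif01_iff: "g \<in> measurable M unif01 \<longleftrightarrow> g \<in> borel_measurable M"
proof -
  have "measurable M unif01 = borel_measurable M"
    by (intro measurable_cong_sets) auto
  then show ?thesis by simp
qed

lemma measurable_component_unif01: "i \<in> I \<Longrightarrow> (\<lambda>V. V i) \<in> borel_measurable (PiM I (\<lambda>_. unif01))"
  using measurable_component_singleton[of i I "\<lambda>_. unif01"] by (simp add: measurable_unif01_iff)

lemma measurable_iid_unif_component [measurable]: "(\<lambda>V. V i) \<in> borel_measurable iid_unif"
  unfolding iid_unif_def by (rule measurable_component_unif01) simp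

lemma measurable_iid_unifI: "(\<And>i. (\<lambda>x. g x i) \<in> borel_measurable M) \<Longrightarrow> g \<in> measurable M iid_unif"
  unfolding iid_unif_def
  by (intro measurable_PiM_single') (auto simp: space_PiM measurable_unif01_iff)

lemma distr_iid_unif_reindex:
  "inj h \<Longrightarrow> distr iid_unif iid_unif (\<lambda>V. V \<circ> h) = iid_unif"
  using distr_PiM_reindex[of UNIV "\<lambda>_. unif01" h UNIV]
  by (simp add: iid_unif_def prob_space_unif01 restrict_def comp_def)

lemma measurable_comp_iid_unif [measurable]: "(\<lambda>V. V \<circ> h) \<in> measurable iid_unif iid_unif"
  by (rule measurable_iid_unifI) simp

lemma nn_integral_iid_unif_reindex:
  assumes "inj h" and [measurable]: "F \<in> borel_measurable iid_unif"
  shows "(\<integral>\<^sup>+V. F (V \<circ> h) \<partial>iid_unif) = (\<integral>\<^sup>+V. F V \<partial>iid_unif)"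
  using nn_integral_distr[of "\<lambda>V. V \<circ> h" iid_unif iid_unif F]
  by (simp add: distr_iid_unif_reindex[OF \<open>inj h\<close>])

lemma prob_iid_unif_reindex:
  assumes "inj h" and [measurable]: "Measurable.pred iid_unif P"
  shows "iid_unif.prob {V. P (V \<circ> h)} = iid_unif.prob {V. P V}"
  using measure_distr[of "\<lambda>V. V \<circ> h" iid_unif iid_unif "{V. P V}"]
  by (simp add: distr_iid_unif_reindex[OF \<open>inj h\<close>] vimage_def)

lemma indep_vars_iid_unif: "iid_unif.indep_vars (\<lambda>_. unif01) (\<lambda>i V. V i) (UNIV :: 'i set)"
proof (subst iid_unif.indep_vars_iff_distr_eq_PiM')
  have "distr iid_unif unif01 (\<lambda>V. V i) = unif01" for i :: 'i
    unfolding iid_unif_def by (rule distr_PiM_component) (auto intro: prob_space_unif01)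
  then show "distr iid_unif (PiM UNIV (\<lambda>i. unif01)) (\<lambda>V. \<lambda>i\<in>UNIV. V i) =
      PiM UNIV (\<lambda>i::'i. distr iid_unif unif01 (\<lambda>V. V i))"
    using distr_iid_unif_reindex[of "\<lambda>i::'i. i"] by (simp add: iid_unif_def restrict_def comp_def)
qed (auto simp: measurable_unif01_iff)

lemma nn_integral_iid_unif_indep:
  fixes F G :: "('i \<Rightarrow> real) \<Rightarrow> ennreal"
  assumes [measurable]: "F \<in> borel_measurable iid_unif" "G \<in> borel_measurable iid_unif"
    and dep: "depends_on J F" "depends_on K G" and disj: "J \<inter> K = {}"
  shows "(\<integral>\<^sup>+V. F V * G V \<partial>iid_unif) = (\<integral>\<^sup>+V. F V \<partial>iid_unif) * (\<integral>\<^sup>+V. G V \<partial>iid_unif)"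
proof -
  define extend :: "'i set \<Rightarrow> ('i \<Rightarrow> real) \<Rightarrow> 'i \<Rightarrow> real"
    where "extend I V i = (if i \<in> I then V i else 0)" for I V i
  have extend: "extend I \<in> measurable (PiM I (\<lambda>_. unif01)) iid_unif" for I
  proof (rule measurable_iid_unifI)
    show "(\<lambda>V. extend I V i) \<in> borel_measurable (PiM I (\<lambda>_. unif01))" for i
      by (cases "i \<in> I") (simp_all add: extend_def measurable_component_unif01)
  qed
  have F_extend: "F (extend J (restrict V J)) = F V" and G_extend: "G (extend K (restrict V K)) = G V" for V
    by (rule depends_onD[OF dep(1)], simp add: extend_def) (rule depends_onD[OF dep(2)], simp add: extend_def)
  have "iid_unif.indep_var (PiM J (\<lambda>_. unif01)) (\<lambda>V. restrict V J) (PiM K (\<lambda>_. unif01)) (\<lambda>V. restrict V K)"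
    using iid_unif.indep_var_restrict[OF indep_vars_iid_unif disj] by simp
  then have "iid_unif.indep_var borel ((F \<circ> extend J) \<circ> (\<lambda>V. restrict V J))
      borel ((G \<circ> extend K) \<circ> (\<lambda>V. restrict V K))"
    by (rule iid_unif.indep_var_compose) (use extend in \<open>auto intro: measurable_comp\<close>)
  then have "iid_unif.indep_vars (\<lambda>_. borel) (case_bool F G) UNIV"
    unfolding iid_unif.indep_var_def comp_def F_extend G_extend
    by (simp cong: iid_unif.indep_vars_cong add: bool.case_eq_if)
  from iid_unif.indep_vars_nn_integral[OF _ this] show ?thesis
    by (simp add: UNIV_bool mult.commute)
qed

lemma prob_iid_unif_indep:
  assumes [measurable]: "Measurable.pred iid_unif P" "Measurable.pred iid_unif Q"
    and "depends_on J P" "depends_on K Q" "J \<inter> K = {}"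
  shows "iid_unif.prob {V. P V \<and> Q V} = iid_unif.prob {V. P V} * iid_unif.prob {V. Q V}"
proof -
  have "ennreal (iid_unif.prob {V. P V \<and> Q V}) = (\<integral>\<^sup>+V. of_bool (P V) * of_bool (Q V) \<partial>iid_unif)"
    by (simp add: iid_unif.nn_integral_of_bool flip: of_bool_conj)
  also have "\<dots> = (\<integral>\<^sup>+V. of_bool (P V) \<partial>iid_unif) * (\<integral>\<^sup>+V. of_bool (Q V) \<partial>iid_unif)"
    using assms by (intro nn_integral_iid_unif_indep depends_on_compose[where h = of_bool]) auto
  also have "\<dots> = ennreal (iid_unif.prob {V. P V} * iid_unif.prob {V. Q V})"
    by (simp add: iid_unif.nn_integral_of_bool ennreal_mult)
  finally show ?thesis by simp
qed

lemma emeasure_unif01_less_iff: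
  assumes "0 \<le> c" "c \<le> 1"
  shows "emeasure unif01 {u. (u < c) = b} = ennreal (if b then c else 1 - c)"
proof -
  have "{0..1} \<inter> {..<c} = {0..<c}" "{0..1} \<inter> {c..} = {c..1}"
    using assms by auto
  moreover have "{u. (u < c) = b} = (if b then {..<c} else {c..})"
    by auto
  ultimately show ?thesis
    using assms by (simp add: divide_ennreal_def)
qed

lemma prob_iid_unif_less_iff:
  assumes "0 \<le> c" "c \<le> 1"
  shows "iid_unif.prob {V. (V i < c) = b} = (if b then c else 1 - c)"
proof -
  have "distr iid_unif unif01 (\<lambda>V. V i) = unif01"
    unfolding iid_unif_def by (rule distr_PiM_component) (auto intro: prob_space_unif01)
  then have "emeasure iid_unif {V. (V i < c) = b} = emeasure unif01 {u. (u < c) = b}"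
    using emeasure_distr[of "\<lambda>V. V i" iid_unif unif01 "{u. (u < c) = b}"]
    by (simp add: measurable_unif01_iff vimage_def)
  also have "\<dots> = ennreal (if b then c else 1 - c)"
    using assms by (rule emeasure_unif01_less_iff)
  finally show ?thesis
    using assms by (auto simp: iid_unif.emeasure_eq_measure)
qed

lemma prob_iid_unif_all_less_iff:
  fixes n :: nat
  assumes "inj_on h {..<n}" and "\<And>k. k < n \<Longrightarrow> 0 \<le> c k \<and> c k \<le> 1"
  shows "iid_unif.prob {V. \<forall>k<n. (V (h k) < c k) = b k} = (\<Prod>k<n. if b k then c k else 1 - c k)"
  using assms
proof (induction n)
  case (Suc n)
  have "iid_unif.prob {V. (\<forall>k<n. (V (h k) < c k) = b k) \<and> (V (h n) < c n) = b n} =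
      iid_unif.prob {V. \<forall>k<n. (V (h k) < c k) = b k} * iid_unif.prob {V. (V (h n) < c n) = b n}"
  proof (rule prob_iid_unif_indep)
    show "depends_on (h ` {..<n}) (\<lambda>V. \<forall>k<n. (V (h k) < c k) = b k)"
      "depends_on {h n} (\<lambda>V. (V (h n) < c n) = b n)"
      by (auto simp: depends_on_def)
    show "h ` {..<n} \<inter> {h n} = {}"
      using inj_onD[OF Suc.prems(1)] by fastforce
  qed measurable
  moreover have "inj_on h {..<n}"
    using Suc.prems(1) by (rule inj_on_subset) auto
  ultimately show ?case
    using Suc by (simp add: All_less_Suc conj_commute prob_iid_unif_less_iff)
qed simp

lemma AE_iid_unif_infinitely_often_less_iff:
  fixes h :: "nat \<Rightarrow> 'i"
  assumes "inj h" and c_unit: "0 \<le> c" "c \<le> 1" and pos: "0 < (if b then c else 1 - c)"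
  shows "AE V in iid_unif. infinite {k. (V (h k) < c) = b}"
proof -
  define q where "q = 1 - (if b then c else 1 - c)"
  have q_unit: "0 \<le> q" "q < 1"
    using c_unit pos by (auto simp: q_def)
  have "AE V in iid_unif. \<exists>k\<ge>m. (V (h k) < c) = b" for m
  proof -
    let ?never = "\<lambda>V. \<forall>k. (V (h (m + k)) < c) = (\<not> b)"
    have "iid_unif.prob {V. ?never V} \<le> q ^ n" for n
    proof -
      have "iid_unif.prob {V. ?never V} \<le> iid_unif.prob {V. \<forall>k<n. (V (h (m + k)) < c) = (\<not> b)}"
        by (intro iid_unif.finite_measure_mono) auto
      also have "\<dots> = q ^ n"
        using c_unit inj_eq[OF \<open>inj h\<close>]
        by (subst prob_iid_unif_all_less_iff) (auto simp: q_def inj_on_def)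
      finally show ?thesis .
    qed
    moreover have "(\<lambda>n. q ^ n) \<longlonglongrightarrow> 0"
      using q_unit by (rule LIMSEQ_realpow_zero)
    ultimately have "iid_unif.prob {V. ?never V} \<le> 0"
      by (intro LIMSEQ_le_const[of "\<lambda>n. q ^ n"]) auto
    then have "AE V in iid_unif. \<not> ?never V"
      using iid_unif.prob_eq_0[of "{V. ?never V}"] by (simp add: measure_le_0_iff)
    then show ?thesis
      by eventually_elim (simp, metis le_add1)
  qed
  then show ?thesis
    unfolding infinite_nat_iff_unbounded_le by (simp add: AE_all_countable)
qed

section \<open>Walks driven by arrow stacks\<close>

definition visits_before :: "(nat \<Rightarrow> int) \<Rightarrow> nat \<Rightarrow> int \<Rightarrow> nat" where
  "visits_before X n x = count_below (\<lambda>k. X k = x) n"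

definition steps_before :: "(nat \<Rightarrow> int) \<Rightarrow> nat \<Rightarrow> int \<Rightarrow> int \<Rightarrow> nat" where
  "steps_before X n x y = count_below (\<lambda>k. X k = x \<and> X (Suc k) = y) n"

definition first_hit :: "(nat \<Rightarrow> int) \<Rightarrow> nat \<Rightarrow> int \<Rightarrow> bool" where
  "first_hit X n k \<longleftrightarrow> X n = k \<and> (\<forall>m<n. X m \<noteq> k)"

text \<open>
  The number of down arrows above the \<open>m + 1\<close>st up arrow of the stack \<open>s\<close>; it is only meaningful if
  such an up arrow exists, since \<open>card\<close> of an infinite set is 0.
\<close>

definition downs_before_up :: "(nat \<Rightarrow> bool) \<Rightarrow> nat \<Rightarrow> nat" where
  "downs_before_up s m = card {j. \<not> s j \<and> count_below s j \<le> m}"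

text \<open>
  \<open>cross_count A j x\<close> is the number of steps from \<open>x + 1\<close> to \<open>x\<close> made before \<open>x + 1 + j\<close> is first hit:
  at that time \<open>x + 1\<close> has been left upwards once more often than the edge above it has been
  crossed downwards, the last time upwards.
\<close>

primrec cross_count :: "(int \<Rightarrow> nat \<Rightarrow> bool) \<Rightarrow> nat \<Rightarrow> int \<Rightarrow> nat" where
  "cross_count A 0 x = 0"
| "cross_count A (Suc j) x = downs_before_up (A (x + 1)) (cross_count A j (x + 1))"

definition never_crossed_back :: "(int \<Rightarrow> nat \<Rightarrow> bool) \<Rightarrow> int \<Rightarrow> bool" where
  "never_crossed_back A x \<longleftrightarrow> (\<forall>j. cross_count A j x = 0)"

text \<open>The walk started at 0 hits \<open>m + 1\<close> before it returns to 0, provided that it hits \<open>m + 1\<close>.\<close>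

definition direct_to :: "(int \<Rightarrow> nat \<Rightarrow> bool) \<Rightarrow> nat \<Rightarrow> bool" where
  "direct_to A m \<longleftrightarrow> A 0 0 \<and> cross_count A m 0 = 0"

lemma downs_before_up_eq_0:
  assumes "\<And>i. i \<le> m \<Longrightarrow> s i"
  shows "downs_before_up s m = 0"
proof -
  have "m < count_below s j" if "\<not> s j" for j
  proof -
    have "Suc m = count_below s (Suc m)"
      using assms
      by (subst count_below_cong[where Q = "\<lambda>k. k < Suc m"]) (simp_all add: count_below_less_eq_min)
    also have "\<dots> \<le> count_below s j"
      using assms that by (intro count_below_mono) (meson not_less_eq_eq)
    finally show ?thesis by simp
  qed
  then have "{j. \<not> s j \<and> count_below s j \<le> m} = {}"
    by force
  then show ?thesis
    by (simp only: downs_before_up_def card.empty)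
qed

lemma cross_count_cong:
  assumes "\<And>z. x < z \<Longrightarrow> z \<le> x + int j \<Longrightarrow> A z = A' z"
  shows "cross_count A j x = cross_count A' j x"
  using assms
proof (induction j arbitrary: x)
  case (Suc j)
  have "cross_count A j (x + 1) = cross_count A' j (x + 1)"
    using Suc.prems by (intro Suc.IH) auto
  moreover have "A (x + 1) = A' (x + 1)"
    using Suc.prems by auto
  ultimately show ?case by simp
qed simp

lemma cross_count_shift: "cross_count (\<lambda>z. A (z + c)) j x = cross_count A j (x + c)"
  by (induction j arbitrary: x) (simp_all add: algebra_simps)

lemma visits_before_0 [simp]: "visits_before X 0 x = 0"
  by (simp add: visits_before_def)

lemma steps_before_0 [simp]: "steps_before X 0 x y = 0"
  by (simp add: steps_before_def)

lemma visits_before_Suc: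
  "visits_before X (Suc n) x = visits_before X n x + (if X n = x then 1 else 0)"
  by (simp add: visits_before_def count_below_Suc)

lemma steps_before_Suc:
  "steps_before X (Suc n) x y = steps_before X n x y + (if X n = x \<and> X (Suc n) = y then 1 else 0)"
  by (simp add: steps_before_def count_below_Suc)

lemma steps_before_mono: "m \<le> n \<Longrightarrow> steps_before X m x y \<le> steps_before X n x y"
  unfolding steps_before_def by (rule count_below_mono)

lemma steps_before_eq_0_iff: "steps_before X n x y = 0 \<longleftrightarrow> (\<forall>k<n. X k = x \<longrightarrow> X (Suc k) \<noteq> y)"
  by (induction n) (auto simp: steps_before_Suc less_Suc_eq)

lemma infinite_visits_if_infinite_steps:
  assumes "\<And>N. \<exists>n. N \<le> steps_before X n x y"
  shows "infinite {n. X n = y}"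
proof -
  have "infinite {k. X k = x \<and> X (Suc k) = y}"
    using assms by (simp add: infinite_iff_count_below_unbounded steps_before_def)
  then have "infinite (Suc ` {k. X k = x \<and> X (Suc k) = y})"
    by (simp add: finite_image_iff)
  then show ?thesis
    by (rule contrapos_nn) (auto elim!: finite_subset[rotated])
qed

locale stack_walk =
  fixes A :: "int \<Rightarrow> nat \<Rightarrow> bool" and X :: "nat \<Rightarrow> int"
  assumes X_0: "X 0 = 0"
    and X_Suc: "X (Suc n) = X n + (if A (X n) (visits_before X n (X n)) then 1 else - 1)"
begin

lemma ups_before_eq: "steps_before X n x (x + 1) = count_below (A x) (visits_before X n x)"
  by (induction n) (auto simp: steps_before_Suc visits_before_Suc count_below_Suc X_Suc)

lemma downs_before_eq: "steps_before X n x (x - 1) = count_below (\<lambda>j. \<not> A x j) (visits_before X n x)"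
  by (induction n) (auto simp: steps_before_Suc visits_before_Suc count_below_Suc X_Suc)

lemma step_balance:
  assumes "0 \<le> x"
  shows "steps_before X n x (x + 1) = steps_before X n (x + 1) x + (if x < X n then 1 else 0)"
proof (induction n)
  case 0
  then show ?case using assms by (simp add: X_0)
next
  case (Suc n)
  then show ?case
    by (cases "A (X n) (visits_before X n (X n))")
       (auto simp: steps_before_Suc X_Suc split: if_splits)
qed

lemma last_arrow_up:
  assumes "0 \<le> x" "x < X n"
  shows "0 < visits_before X n x \<and> A x (visits_before X n x - 1)"
  using assms(2)
proof (induction n)
  case 0
  then show ?case using assms(1) by (simp add: X_0)
next
  case (Suc n)
  then show ?case
    by (cases "X n = x"; cases "x < X n") (auto simp: visits_before_Suc X_Suc split: if_splits)
qed

lemma downs_before_rec: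
  assumes "0 \<le> x" "x < X n"
  shows "steps_before X n x (x - 1) = downs_before_up (A x) (steps_before X n (x + 1) x)"
proof -
  define L where "L = visits_before X n x"
  define m where "m = steps_before X n (x + 1) x"
  have last_up: "0 < L" "A x (L - 1)"
    using last_arrow_up[OF assms] by (auto simp: L_def)
  have ups: "count_below (A x) L = Suc m"
    using step_balance[OF assms(1), of n] assms(2) ups_before_eq[of n x] by (simp add: L_def m_def)
  have before_last_up: "count_below (A x) j \<le> m \<longleftrightarrow> j < L" for j
  proof
    assume "j < L"
    then have "count_below (A x) j \<le> count_below (A x) (L - 1)"
      by (intro count_below_mono) simp
    moreover have "count_below (A x) (L - 1) = m"
      using count_below_Suc[of "A x" "L - 1"] last_up ups by simp
    ultimately show "count_below (A x) j \<le> m" by simp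
  next
    assume few: "count_below (A x) j \<le> m"
    show "j < L"
    proof (rule ccontr)
      assume "\<not> j < L"
      then have "count_below (A x) L \<le> count_below (A x) j"
        by (intro count_below_mono) simp
      with few ups show False by simp
    qed
  qed
  have "{j. \<not> A x j \<and> count_below (A x) j \<le> m} = {j. j < L \<and> \<not> A x j}"
    unfolding before_last_up by blast
  then have "downs_before_up (A x) m = count_below (\<lambda>j. \<not> A x j) L"
    by (simp only: downs_before_up_def count_below_def)
  then show ?thesis
    by (simp add: downs_before_eq L_def m_def)
qed

lemma downs_before_first_hit:
  assumes "first_hit X n (x + 1 + int j)" "0 \<le> x"
  shows "steps_before X n (x + 1) x = cross_count A j x"
  using assms
proof (induction j arbitrary: x)
  case 0
  then show ?case
    by (simp add: first_hit_def steps_before_eq_0_iff)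
next
  case (Suc j)
  have "steps_before X n (x + 1 + 1) (x + 1) = cross_count A j (x + 1)"
    using Suc.prems by (intro Suc.IH) (auto simp: algebra_simps)
  moreover have "x + 1 < X n"
    using Suc.prems by (simp add: first_hit_def)
  ultimately show ?case
    using downs_before_rec[of "x + 1" n] Suc.prems by simp
qed

lemma first_hit_exists:
  assumes "k \<le> X m" "0 \<le> k"
  shows "\<exists>n\<le>m. first_hit X n k"
proof -
  define n where "n = (LEAST n. k \<le> X n)"
  have n_reaches: "k \<le> X n" "n \<le> m"
    unfolding n_def using assms by (auto intro: LeastI Least_le)
  have below: "X i < k" if "i < n" for i
    using not_less_Least[of i "\<lambda>n. k \<le> X n"] that by (auto simp: n_def)
  have "X n = k"
  proof (cases n)
    case 0
    then show ?thesis using n_reaches assms(2) by (simp add: X_0)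
  next
    case (Suc i)
    then show ?thesis using n_reaches below[of i] by (simp add: X_Suc split: if_splits)
  qed
  then show ?thesis
    using below n_reaches(2) by (force simp: first_hit_def)
qed

lemma X_less_if_not_hit:
  assumes "\<And>i. i \<le> n \<Longrightarrow> X i \<noteq> k" "0 \<le> k"
  shows "X n < k"
  using first_hit_exists[of k n] assms by (force simp: first_hit_def)

lemma X_le: "X n \<le> int n"
  by (induction n) (simp_all add: X_0 X_Suc)

lemma count_below_visits_unbounded:
  assumes "infinite {j. P j}" "infinite {n. X n = x}"
  shows "\<exists>n. N \<le> count_below P (visits_before X n x)"
proof -
  obtain j where j_count: "N \<le> count_below P j"
    using assms(1) by (auto simp: infinite_iff_count_below_unbounded)
  obtain n where "j \<le> visits_before X n x"
    using assms(2) by (auto simp: infinite_iff_count_below_unbounded visits_before_def)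
  then show ?thesis
    using j_count count_below_mono[of j _ P] by (meson order_trans)
qed

end

locale full_stack_walk = stack_walk +
  assumes full_up: "infinite {j. A x j}" and full_down: "infinite {j. \<not> A x j}"
begin

lemma infinite_neighbours:
  assumes "infinite {n. X n = x}"
  shows "infinite {n. X n = x + 1}" "infinite {n. X n = x - 1}"
  using count_below_visits_unbounded[OF full_up assms] count_below_visits_unbounded[OF full_down assms]
  by (auto intro!: infinite_visits_if_infinite_steps[of X x] simp: ups_before_eq downs_before_eq)

lemma infinite_all_sites:
  assumes "infinite {n. X n = x}"
  shows "infinite {n. X n = y}"
proof -
  have "infinite {n. X n = x + int d} \<and> infinite {n. X n = x - int d}" for d
  proof (induction d)
    case (Suc d)
    then show ?case
      using infinite_neighbours(1)[of "x + int d"] infinite_neighbours(2)[of "x - int d"]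
      by (simp add: algebra_simps)
  qed (use assms in simp)
  from this[of "nat \<bar>y - x\<bar>"] show ?thesis
    by (cases "x \<le> y") (auto simp: algebra_simps)
qed

lemma escapes_left:
  assumes "\<And>n. X n \<noteq> k" "0 \<le> k"
  shows "\<forall>\<^sub>F n in sequentially. X n < - int m"
proof -
  have "finite {n. X n = x}" for x
    using infinite_all_sites[of x k] assms(1) by auto
  then have "finite (\<Union>x\<in>{- int m..k}. {n. X n = x})"
    by auto
  also have "(\<Union>x\<in>{- int m..k}. {n. X n = x}) = {n. \<not> X n \<notin> {- int m..k}}"
    by auto
  finally have "\<forall>\<^sub>F n in sequentially. X n \<notin> {- int m..k}"
    unfolding cofinite_eq_sequentially[symmetric] eventually_cofinite .
  then show ?thesis
  proof eventually_elim
    case (elim n)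
    then show ?case
      using X_less_if_not_hit[of n k] assms by force
  qed
qed

end

locale right_reaching_stack_walk = stack_walk +
  assumes hits: "0 \<le> k \<Longrightarrow> \<exists>n. X n = k"
begin

lemma first_hit_hits: "0 \<le> k \<Longrightarrow> \<exists>n. first_hit X n k"
  using hits first_hit_exists by (metis order_refl)

lemma late_first_hit:
  assumes "\<And>i. i \<le> n \<Longrightarrow> X i < k" "0 \<le> k"
  shows "\<exists>n'\<ge>n. first_hit X n' k"
  using first_hit_hits[OF assms(2)] assms(1) by (metis first_hit_def less_irrefl nle_le)

lemma cross_count_mono: "cross_count A j 0 \<le> cross_count A (Suc j) 0"
proof -
  obtain n where hit_n: "first_hit X n (0 + 1 + int (Suc j))"
    using first_hit_hits[of "0 + 1 + int (Suc j)"] by auto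
  then obtain m where hit_m: "m \<le> n" "first_hit X m (0 + 1 + int j)"
    using first_hit_exists[of "0 + 1 + int j" n] by (auto simp: first_hit_def)
  show ?thesis
    using steps_before_mono[OF hit_m(1)] unfolding downs_before_first_hit[OF hit_n order_refl, symmetric]
      downs_before_first_hit[OF hit_m(2) order_refl, symmetric] .
qed

lemma eventually_downs_before_le_cross_count:
  assumes "0 \<le> x"
  shows "\<forall>\<^sub>F j in sequentially. steps_before X n (x + 1) x \<le> cross_count A j x"
proof (rule eventually_sequentiallyI)
  fix j assume "n + nat x \<le> j"
  then have "X i < x + 1 + int j" if "i \<le> n" for i
    using X_le[of i] that assms by auto
  then obtain n' where "n \<le> n'" "first_hit X n' (x + 1 + int j)"
    using late_first_hit[of n "x + 1 + int j"] assms by auto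
  then show "steps_before X n (x + 1) x \<le> cross_count A j x"
    using downs_before_first_hit[of n' x j] steps_before_mono[of n n' X "x + 1" x] assms by simp
qed

lemma visits_before_le_1_if_never_crossed_back:
  assumes "0 \<le> x" "never_crossed_back A x" "A x 0"
  shows "visits_before X n x \<le> 1"
proof (induction n)
  case (Suc n)
  have "visits_before X n x = 0" if "X n = x"
  proof -
    have "\<exists>j. steps_before X n (x + 1) x \<le> cross_count A j x"
      using eventually_happens[OF eventually_downs_before_le_cross_count[OF assms(1)]] by simp
    then have "count_below (A x) (visits_before X n x) = 0"
      using step_balance[OF assms(1), of n] that assms(2)
      by (auto simp: never_crossed_back_def simp flip: ups_before_eq)
    then show ?thesis
      using \<open>A x 0\<close> count_below_mono[of 1 "visits_before X n x" "A x"] by (fastforce simp: count_below_Suc)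
  qed
  with Suc.IH show ?case
    by (auto simp: visits_before_Suc)
qed simp

lemma cross_count_bounded:
  assumes "finite {n. X n = 1}"
  shows "cross_count A j 0 \<le> card {n. X n = 1}"
proof -
  obtain n where "first_hit X n (0 + 1 + int j)"
    using first_hit_hits[of "0 + 1 + int j"] by auto
  then have "cross_count A j 0 = steps_before X n 1 0"
    using downs_before_first_hit[of n 0 j] by simp
  also have "\<dots> \<le> card {n. X n = 1}"
    unfolding steps_before_def count_below_def using assms by (intro card_mono) auto
  finally show ?thesis .
qed

lemma eventually_cross_count_ge:
  assumes "infinite {n. X n = 1}" "infinite {j. \<not> A 1 j}"
  shows "\<forall>\<^sub>F j in sequentially. N \<le> cross_count A j 0"
proof -
  obtain n where "N \<le> steps_before X n (0 + 1) 0"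
    using count_below_visits_unbounded[OF assms(2,1)] downs_before_eq[of _ 1] by auto
  with eventually_downs_before_le_cross_count[OF order_refl, of n] show ?thesis
    by (auto elim: eventually_mono)
qed

end

section \<open>Walks stopped on leaving a set\<close>

text \<open>The starting point is exempt, so that an excursion from 0 can be described by a set without 0.\<close>

definition stays_in :: "(nat \<Rightarrow> int) \<Rightarrow> int set \<Rightarrow> nat \<Rightarrow> bool" where
  "stays_in X G n \<longleftrightarrow> X ` {1..n} \<subseteq> G"

definition exit_gain :: "(nat \<Rightarrow> int) \<Rightarrow> int set \<Rightarrow> nat \<Rightarrow> real" where
  "exit_gain X G n = (\<Sum>i<n. of_bool (stays_in X G i) * of_int (X (Suc i) - X i))"

definition site_weight ::
    "(int \<Rightarrow> nat \<Rightarrow> real) \<Rightarrow> (nat \<Rightarrow> int) \<Rightarrow> int set \<Rightarrow> nat \<Rightarrow> int \<Rightarrow> real" where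
  "site_weight d X G n x = (\<Sum>i<n. of_bool (stays_in X G i \<and> X i = x) * d x (visits_before X i x))"

lemma stays_in_0 [simp]: "stays_in X G 0"
  by (simp add: stays_in_def)

lemma stays_in_Suc: "stays_in X G (Suc n) \<longleftrightarrow> stays_in X G n \<and> X (Suc n) \<in> G"
  by (auto simp: stays_in_def atLeastAtMostSuc_conv)

lemma stays_inD: "stays_in X G n \<Longrightarrow> 1 \<le> i \<Longrightarrow> i \<le> n \<Longrightarrow> X i \<in> G"
  by (auto simp: stays_in_def)

lemma stays_in_antimono: "m \<le> n \<Longrightarrow> stays_in X G n \<Longrightarrow> stays_in X G m"
  by (auto simp: stays_in_def)

lemma exit_gain_telescope:
  obtains m where "m \<le> n" "\<And>i. i < m \<Longrightarrow> stays_in X G i" "m = n \<or> \<not> stays_in X G m"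
    "exit_gain X G n = of_int (X m - X 0)"
proof -
  have "\<exists>m\<le>n. (\<forall>i<m. stays_in X G i) \<and> (m = n \<or> \<not> stays_in X G m) \<and> exit_gain X G n = of_int (X m - X 0)"
  proof (induction n)
    case 0
    then show ?case by (simp add: exit_gain_def)
  next
    case (Suc n)
    then obtain m where m_exit: "m \<le> n" "\<forall>i<m. stays_in X G i" "m = n \<or> \<not> stays_in X G m"
      "exit_gain X G n = of_int (X m - X 0)"
      by blast
    show ?case
    proof (cases "stays_in X G n")
      case True
      then have "m = n"
        using m_exit stays_in_antimono by blast
      with True m_exit show ?thesis
        by (intro exI[of _ "Suc n"]) (auto simp: exit_gain_def less_Suc_eq)
    next
      case False
      with m_exit show ?thesis
        by (intro exI[of _ m]) (auto simp: exit_gain_def)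
    qed
  qed
  then show thesis
    using that by blast
qed

lemma sum_site_weight:
  assumes "finite S"
  shows "(\<Sum>x\<in>S. site_weight d X G n x) =
    (\<Sum>i<n. of_bool (stays_in X G i \<and> X i \<in> S) * d (X i) (visits_before X i (X i)))"
proof -
  have "(\<Sum>x\<in>S. of_bool (stays_in X G i \<and> X i = x) * d x (visits_before X i x)) =
      of_bool (stays_in X G i \<and> X i \<in> S) * d (X i) (visits_before X i (X i))" for i
  proof -
    have "(\<Sum>x\<in>S. of_bool (stays_in X G i \<and> X i = x) * d x (visits_before X i x)) =
        (\<Sum>x\<in>S. if x = X i then of_bool (stays_in X G i) * d (X i) (visits_before X i (X i)) else 0)"
      by (intro sum.cong) auto
    then show ?thesis
      using assms by (simp add: of_bool_conj)
  qed
  then show ?thesis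
    unfolding site_weight_def by (subst sum.swap) simp
qed

lemma site_weight_nonneg: "(\<And>i. 0 \<le> d x i) \<Longrightarrow> 0 \<le> site_weight d X G n x"
  unfolding site_weight_def by (intro sum_nonneg) simp

lemma site_weight_outside_le:
  assumes "x \<notin> G" "0 \<le> d x 0"
  shows "site_weight d X G n x \<le> d x 0"
proof (induction n)
  case 0
  then show ?case using assms(2) by (simp add: site_weight_def)
next
  case (Suc n)
  then show ?case
    using assms stays_inD[of X G n n] by (cases "n = 0") (auto simp: site_weight_def)
qed

lemma site_weight_eq_sum_visits:
  assumes "\<And>i. i < n \<Longrightarrow> stays_in X G i"
  shows "site_weight d X G n x = (\<Sum>i<visits_before X n x. d x i)"
  using assms by (induction n) (auto simp: site_weight_def visits_before_Suc)

lemma site_weight_le_sum_visits: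
  assumes "\<And>i. 0 \<le> d x i"
  shows "site_weight d X G n x \<le> (\<Sum>i<visits_before X n x. d x i)"
proof -
  have "site_weight d X G n x \<le> site_weight d X UNIV n x"
    unfolding site_weight_def using assms by (intro sum_mono mult_right_mono) (auto simp: stays_in_def)
  also have "\<dots> = (\<Sum>i<visits_before X n x. d x i)"
    by (rule site_weight_eq_sum_visits) (simp add: stays_in_def)
  finally show ?thesis .
qed

context stack_walk
begin

lemma X_diff_le_1: "X (Suc n) \<le> X n + 1" "X n - 1 \<le> X (Suc n)"
  by (simp_all add: X_Suc)

lemma exit_gain_below_le:
  assumes "0 < k"
  shows "exit_gain X {..<k} n \<le> of_int k"
proof -
  obtain m where m_exit: "\<And>i. i < m \<Longrightarrow> stays_in X {..<k} i" "exit_gain X {..<k} n = of_int (X m - X 0)"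
    using exit_gain_telescope by metis
  have "X m \<le> k"
  proof (cases m)
    case (Suc i)
    then have "X i < k"
      using m_exit(1)[of i] assms by (cases i) (auto simp: X_0 stays_in_Suc)
    then show ?thesis
      using X_diff_le_1(1)[of i] Suc by simp
  qed (use assms in \<open>simp add: X_0\<close>)
  then show ?thesis
    by (simp add: m_exit(2) X_0)
qed

lemma exit_gain_if_stays_in: "stays_in X G n \<Longrightarrow> exit_gain X G n = of_int (X n)"
  by (rule exit_gain_telescope[of n X G]) (auto simp: X_0 dest: stays_in_antimono)

lemma exit_gain_excursion_ge: "- 1 \<le> exit_gain X {0<..<k} n"
proof -
  obtain m where m_exit: "\<And>i. i < m \<Longrightarrow> stays_in X {0<..<k} i" "exit_gain X {0<..<k} n = of_int (X m - X 0)"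
    using exit_gain_telescope by metis
  have "- 1 \<le> X m"
  proof (cases m)
    case (Suc i)
    then have "0 \<le> X i"
      using m_exit(1)[of i] by (cases i) (auto simp: X_0 stays_in_Suc)
    then show ?thesis
      using X_diff_le_1(2)[of i] Suc by simp
  qed (simp add: X_0)
  then show ?thesis
    by (simp add: m_exit(2) X_0)
qed

lemma direct_to_if_stays_positive:
  assumes "stays_in X {0<..} n" "X n = int (Suc m)"
  shows "direct_to A m"
proof -
  have "n \<noteq> 0"
    using assms(2) by (auto simp: X_0 intro: gr0I)
  then have "0 < X 1"
    using stays_inD[OF assms(1), of 1] by simp
  then have "A 0 0"
    using X_Suc[of 0] by (auto simp: X_0 split: if_splits)
  moreover obtain n' where n': "n' \<le> n" "first_hit X n' (0 + 1 + int m)"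
    using first_hit_exists[of "0 + 1 + int m" n] assms(2) by auto
  have "X (Suc i) \<noteq> 0" if "i < n'" for i
    using stays_inD[OF assms(1), of "Suc i"] n'(1) that by simp
  then have "steps_before X n' (0 + 1) 0 = 0"
    by (simp add: steps_before_eq_0_iff)
  then have "cross_count A m 0 = 0"
    using downs_before_first_hit[OF n'(2)] by simp
  ultimately show ?thesis
    by (simp add: direct_to_def)
qed

lemma stays_positive_if_direct_to:
  assumes "direct_to A m" "first_hit X n (int (Suc m))" "i \<le> n"
  shows "stays_in X {0<..} i"
  using assms(3)
proof (induction i)
  case (Suc i)
  have "steps_before X n (0 + 1) 0 = 0"
    using downs_before_first_hit[of n 0 m] assms(1,2) by (simp add: direct_to_def)
  then have no_return: "X i = 1 \<longrightarrow> X (Suc i) \<noteq> 0"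
    using Suc.prems by (simp add: steps_before_eq_0_iff)
  have "0 < X (Suc i)"
  proof (cases i)
    case 0
    then show ?thesis
      using assms(1) by (simp add: direct_to_def X_Suc X_0)
  next
    case (Suc i')
    then have "0 < X i"
      using Suc.IH Suc.prems by (simp add: stays_in_Suc)
    then show ?thesis
      using no_return X_diff_le_1(2)[of i] by linarith
  qed
  then show ?case
    using Suc.IH Suc.prems by (simp add: stays_in_Suc)
qed simp

lemma exit_gain_excursion_direct:
  assumes "direct_to A m" "X i = int (Suc m)" "i \<le> n"
  shows "exit_gain X {0<..<int (Suc m)} n = real (Suc m)"
proof -
  let ?G = "{0<..<int (Suc m)}"
  obtain h where h_hit: "h \<le> i" "first_hit X h (int (Suc m))"
    using first_hit_exists[of "int (Suc m)" i] assms(2) by auto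
  have below: "X j < int (Suc m)" if "j < h" for j
    using X_less_if_not_hit[of j "int (Suc m)"] h_hit(2) that by (auto simp: first_hit_def)
  have stays: "stays_in X ?G j" if "j < h" for j
  proof -
    have "X i \<in> ?G" if "1 \<le> i" "i \<le> j" for i
      using stays_inD[OF stays_positive_if_direct_to[OF assms(1) h_hit(2)], of j i] below[of i] that \<open>j < h\<close>
      by simp
    then show ?thesis
      by (auto simp: stays_in_def)
  qed
  have "h \<noteq> 0" "X h = int (Suc m)"
    using h_hit(2) by (auto simp: first_hit_def X_0 intro: gr0I)
  then have leaves: "\<not> stays_in X ?G h"
    using stays_inD[of X ?G h h] by auto
  obtain l where l_exit: "l \<le> n" "\<And>j. j < l \<Longrightarrow> stays_in X ?G j" "l = n \<or> \<not> stays_in X ?G l"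
    "exit_gain X ?G n = of_int (X l - X 0)"
    using exit_gain_telescope[of n X ?G] by metis
  have "l = h"
    using l_exit(1-3) h_hit(1) assms(3) stays leaves by (metis le_trans linorder_neqE_nat not_le)
  then show ?thesis
    using l_exit(4) h_hit(2) by (simp add: first_hit_def X_0)
qed

lemma site_weight_eq_0_if_not_direct_to:
  assumes "\<not> direct_to A m" "G \<subseteq> {0<..}"
  shows "site_weight d X G n (int (Suc m)) = 0"
proof -
  have "\<not> (stays_in X G i \<and> X i = int (Suc m))" for i
    using direct_to_if_stays_positive[of i m] assms by (auto simp: stays_in_def)
  then show ?thesis
    unfolding site_weight_def by (intro sum.neutral ballI) (metis mult_zero_left of_bool_eq(1))
qed

lemma site_weight_ge_if_crossed:
  assumes "0 \<le> x" "first_hit X n (x + 1 + int j)" "N \<le> cross_count A j x" "\<And>i. 0 \<le> d x i"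
  shows "(\<Sum>i<N. d x i) \<le> site_weight d X {..<x + 1 + int j} n x"
proof -
  have "cross_count A j x = steps_before X n (x + 1) x"
    using downs_before_first_hit[OF assms(2,1)] by simp
  also have "\<dots> \<le> steps_before X n x (x + 1)"
    using step_balance[OF assms(1), of n] by simp
  also have "\<dots> \<le> visits_before X n x"
    unfolding ups_before_eq by (rule count_below_le)
  finally have "(\<Sum>i<N. d x i) \<le> (\<Sum>i<visits_before X n x. d x i)"
    using assms(3,4) by (intro sum_mono2) auto
  moreover have "stays_in X {..<x + 1 + int j} i" if "i < n" for i
    using X_less_if_not_hit[of _ "x + 1 + int j"] assms(1,2) that by (force simp: stays_in_def first_hit_def)
  ultimately show ?thesis
    by (simp add: site_weight_eq_sum_visits)
qed

end

section \<open>Nearest-neighbour walks with memory\<close>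

primrec nn_paths :: "nat \<Rightarrow> int list set" where
  "nn_paths 0 = {[0]}"
| "nn_paths (Suc n) = (\<Union>xs\<in>nn_paths n. {xs @ [last xs + 1], xs @ [last xs - 1]})"

lemma finite_nn_paths: "finite (nn_paths n)"
  by (induction n) auto

text \<open>
  \<open>p xs\<close> is the probability of a step up after the path \<open>xs\<close>, and \<open>source xs\<close> is the uniform
  variable that decides this step.
\<close>

locale driven_walk =
  fixes p :: "int list \<Rightarrow> real" and source :: "int list \<Rightarrow> 'i"
  assumes p_nonneg: "0 \<le> p xs" and p_le_1: "p xs \<le> 1"
    and source_fresh: "Suc k < length xs \<Longrightarrow> source (take (Suc k) xs) \<noteq> source xs"
begin

primrec path :: "('i \<Rightarrow> real) \<Rightarrow> nat \<Rightarrow> int list" where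
  "path V 0 = [0]"
| "path V (Suc n) = path V n @ [last (path V n) + (if V (source (path V n)) < p (path V n) then 1 else - 1)]"

definition pos :: "('i \<Rightarrow> real) \<Rightarrow> nat \<Rightarrow> int" where
  "pos V n = last (path V n)"

definition exit_drift :: "('i \<Rightarrow> real) \<Rightarrow> int set \<Rightarrow> nat \<Rightarrow> real" where
  "exit_drift V G n = (\<Sum>i<n. of_bool (stays_in (pos V) G i) * (2 * p (path V i) - 1))"

lemma length_path [simp]: "length (path V n) = Suc n"
  by (induction n) auto

lemma pos_0 [simp]: "pos V 0 = 0"
  by (simp add: pos_def)

lemma pos_Suc: "pos V (Suc n) = pos V n + (if V (source (path V n)) < p (path V n) then 1 else - 1)"
  by (simp add: pos_def)

lemma path_Suc_snoc: "path V (Suc n) = path V n @ [pos V (Suc n)]"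
  by (simp add: pos_def)

lemma path_nth: "k \<le> n \<Longrightarrow> path V n ! k = pos V k"
proof (induction n)
  case (Suc n)
  then show ?case
    unfolding path_Suc_snoc by (cases "k = Suc n") (simp_all add: nth_append)
qed (simp add: pos_def)

lemma path_in_nn_paths: "path V n \<in> nn_paths n"
  by (induction n) auto

lemma set_tl_path: "set (tl (path V n)) = pos V ` {1..n}"
proof (induction n)
  case (Suc n)
  have "path V n \<noteq> []"
    using length_path[of V n] by fastforce
  then show ?case
    unfolding path_Suc_snoc using Suc by (simp add: atLeastAtMostSuc_conv)
qed simp

lemma stays_in_pos_iff: "stays_in (pos V) G n \<longleftrightarrow> set (tl (path V n)) \<subseteq> G"
  by (simp add: stays_in_def set_tl_path)

lemma path_measurable [measurable]: "(\<lambda>V. path V n) \<in> measurable iid_unif (count_space UNIV)"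
proof (induction n)
  case (Suc n)
  define extend where "extend xs V = xs @ [last xs + (if V (source xs) < p xs then 1 else - 1)]" for xs V
  have "extend xs \<in> measurable iid_unif (count_space UNIV)" for xs
    unfolding extend_def by measurable
  then have "(\<lambda>V. extend (path V n) V) \<in> measurable iid_unif (count_space UNIV)"
    by (rule measurable_compose_countable) (rule Suc)
  then show ?case
    by (simp only: extend_def path.simps)
qed simp

lemma pos_measurable [measurable]: "(\<lambda>V. pos V n) \<in> measurable iid_unif (count_space UNIV)"
  unfolding pos_def by measurable

lemma take_path: "k \<le> n \<Longrightarrow> take (Suc k) (path V n) = path V k"
  by (rule nth_equalityI) (auto simp: path_nth)

lemma path_cong:
  assumes "\<And>k. k < n \<Longrightarrow> V (source (path V k)) = W (source (path V k))"
  shows "path W n = path V n"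
  using assms by (induction n) simp_all

lemma depends_on_path_eq: "depends_on ((\<lambda>k. source (take (Suc k) xs)) ` {..<n}) (\<lambda>V. path V n = xs)"
proof (rule depends_onI)
  fix V W :: "'i \<Rightarrow> real"
  assume agree: "\<And>i. i \<in> (\<lambda>k. source (take (Suc k) xs)) ` {..<n} \<Longrightarrow> V i = W i"
  have "V (source (path V k)) = W (source (path V k))" if "path V n = xs" "k < n" for k
    using agree[of "source (take (Suc k) xs)"] that take_path[of k n V] by auto
  moreover have "W (source (path W k)) = V (source (path W k))" if "path W n = xs" "k < n" for k
    using agree[of "source (take (Suc k) xs)"] that take_path[of k n W] by auto
  ultimately show "(path V n = xs) = (path W n = xs)"
    using path_cong[of n V W] path_cong[of n W V] by auto
qed

lemma prob_path_step:
  "iid_unif.prob {V. path V n = xs \<and> (V (source xs) < p xs) = b} =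
   iid_unif.prob {V. path V n = xs} * (if b then p xs else 1 - p xs)"
proof (cases "length xs = Suc n")
  case True
  then have disjoint: "(\<lambda>k. source (take (Suc k) xs)) ` {..<n} \<inter> {source xs} = {}"
    using source_fresh by fastforce
  have dep: "depends_on {source xs} (\<lambda>V. (V (source xs) < p xs) = b)"
    by (simp add: depends_on_def)
  have "iid_unif.prob {V. path V n = xs \<and> (V (source xs) < p xs) = b} =
      iid_unif.prob {V. path V n = xs} * iid_unif.prob {V. (V (source xs) < p xs) = b}"
    by (rule prob_iid_unif_indep[OF _ _ depends_on_path_eq dep disjoint]) measurable
  then show ?thesis
    by (simp only: prob_iid_unif_less_iff[OF p_nonneg p_le_1])
next
  case False
  then have "path V n \<noteq> xs" for V
    using length_path[of V n] by fastforce
  then show ?thesis by simp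
qed

lemma prob_path_snoc:
  "iid_unif.prob {V. path V (Suc n) = xs @ [z]} =
   iid_unif.prob {V. path V n = xs} *
     (of_bool (z = last xs + 1) * p xs + of_bool (z = last xs - 1) * (1 - p xs))"
proof -
  consider (up) "z = last xs + 1" | (down) "z = last xs - 1" | (other) "z \<noteq> last xs + 1" "z \<noteq> last xs - 1"
    by blast
  then show ?thesis
  proof cases
    case up
    then have "path V (Suc n) = xs @ [z] \<longleftrightarrow> path V n = xs \<and> (V (source xs) < p xs) = True" for V
      by auto
    with up show ?thesis
      by (simp only: prob_path_step) simp
  next
    case down
    then have "path V (Suc n) = xs @ [z] \<longleftrightarrow> path V n = xs \<and> (V (source xs) < p xs) = False" for V
      by auto
    with down show ?thesis
      by (simp only: prob_path_step) simp
  next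
    case other
    then have "{V. path V (Suc n) = xs @ [z]} = {}"
      by auto
    with other show ?thesis
      by (simp del: path.simps)
  qed
qed

lemma sum_of_bool_path: "(\<Sum>xs\<in>nn_paths n. g xs * of_bool (path V n = xs)) = (g (path V n) :: real)"
proof -
  have "(\<Sum>xs\<in>nn_paths n. g xs * of_bool (path V n = xs)) = (\<Sum>xs\<in>nn_paths n. if path V n = xs then g xs else 0)"
    by (intro sum.cong) auto
  then show ?thesis
    using path_in_nn_paths finite_nn_paths by simp
qed

lemma integrable_path: "integrable iid_unif (\<lambda>V. g (path V n) :: real)"
proof -
  have "integrable iid_unif (\<lambda>V. \<Sum>xs\<in>nn_paths n. g xs * of_bool (path V n = xs))"
    by (intro Bochner_Integration.integrable_sum integrable_mult_right iid_unif.integrable_of_bool) measurable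
  then show ?thesis
    by (simp only: sum_of_bool_path)
qed

lemma integrable_path_step:
  "integrable iid_unif (\<lambda>V. \<phi> (path V n) * of_int (pos V (Suc n) - pos V n) :: real)"
proof -
  have as_path: "\<phi> (path V n) * of_int (pos V (Suc n) - pos V n) =
      \<phi> (butlast (path V (Suc n))) * of_int (last (path V (Suc n)) - last (butlast (path V (Suc n))))" for V
    by (simp add: pos_def)
  show ?thesis
    unfolding as_path by (rule integrable_path)
qed

lemma integral_path_step:
  "(\<integral>V. \<phi> (path V n) * of_int (pos V (Suc n) - pos V n) \<partial>iid_unif) =
   (\<integral>V. \<phi> (path V n) * (2 * p (path V n) - 1) \<partial>iid_unif :: real)"
proof -
  have step: "\<phi> (path V n) * of_int (pos V (Suc n) - pos V n) =
      (\<Sum>xs\<in>nn_paths n. \<phi> xs * (2 * of_bool (path V n = xs \<and> V (source xs) < p xs) - of_bool (path V n = xs)))"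
    (is "_ = ?sum V") for V
  proof -
    have "of_int (pos V (Suc n) - pos V n) = 2 * of_bool (V (source (path V n)) < p (path V n)) - (1 :: real)"
      by (simp add: pos_Suc)
    then have "\<phi> (path V n) * of_int (pos V (Suc n) - pos V n) =
        (\<Sum>xs\<in>nn_paths n. \<phi> xs * (2 * of_bool (V (source xs) < p xs) - 1) * of_bool (path V n = xs))"
      by (simp only: sum_of_bool_path)
    also have "\<dots> = ?sum V"
      by (intro sum.cong) auto
    finally show ?thesis .
  qed
  have [simp]: "integrable iid_unif (\<lambda>V. of_bool (path V n = xs \<and> V (source xs) < p xs) :: real)"
    "integrable iid_unif (\<lambda>V. of_bool (path V n = xs) :: real)" for xs
    by (intro iid_unif.integrable_of_bool; measurable)+
  have "(\<integral>V. \<phi> (path V n) * of_int (pos V (Suc n) - pos V n) \<partial>iid_unif) =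
      (\<Sum>xs\<in>nn_paths n. \<phi> xs * (2 * iid_unif.prob {V. path V n = xs \<and> V (source xs) < p xs}
         - iid_unif.prob {V. path V n = xs}))"
    unfolding step by (subst Bochner_Integration.integral_sum) (simp_all add: iid_unif.integral_of_bool)
  also have "\<dots> = (\<Sum>xs\<in>nn_paths n. \<phi> xs * (2 * p xs - 1) * iid_unif.prob {V. path V n = xs})"
    using prob_path_step[of n _ True] by (simp add: algebra_simps)
  also have "\<dots> = (\<integral>V. (\<Sum>xs\<in>nn_paths n. \<phi> xs * (2 * p xs - 1) * of_bool (path V n = xs)) \<partial>iid_unif)"
    by (subst Bochner_Integration.integral_sum) (simp_all add: iid_unif.integral_of_bool)
  finally show ?thesis
    by (simp only: sum_of_bool_path)
qed

lemma integrable_exit_gain: "integrable iid_unif (\<lambda>V. exit_gain (pos V) G n)"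
  unfolding exit_gain_def stays_in_pos_iff
  by (intro Bochner_Integration.integrable_sum
      integrable_path_step[where \<phi> = "\<lambda>xs. of_bool (set (tl xs) \<subseteq> G)"])

lemma integrable_exit_drift: "integrable iid_unif (\<lambda>V. exit_drift V G n)"
  unfolding exit_drift_def stays_in_pos_iff
  by (intro Bochner_Integration.integrable_sum
      integrable_path[where g = "\<lambda>xs. of_bool (set (tl xs) \<subseteq> G) * (2 * p xs - 1)"])

lemma integral_exit_gain: "(\<integral>V. exit_gain (pos V) G n \<partial>iid_unif) = (\<integral>V. exit_drift V G n \<partial>iid_unif)"
proof -
  let ?\<phi> = "\<lambda>xs. of_bool (set (tl xs) \<subseteq> G) :: real"
  have "(\<integral>V. exit_gain (pos V) G n \<partial>iid_unif) =
      (\<Sum>i<n. \<integral>V. ?\<phi> (path V i) * of_int (pos V (Suc i) - pos V i) \<partial>iid_unif)"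
    unfolding exit_gain_def stays_in_pos_iff
    by (intro Bochner_Integration.integral_sum integrable_path_step[of ?\<phi>])
  also have "\<dots> = (\<Sum>i<n. \<integral>V. ?\<phi> (path V i) * (2 * p (path V i) - 1) \<partial>iid_unif)"
    by (simp only: integral_path_step[of ?\<phi>])
  also have "\<dots> = (\<integral>V. exit_drift V G n \<partial>iid_unif)"
    unfolding exit_drift_def stays_in_pos_iff
    by (intro Bochner_Integration.integral_sum[symmetric] integrable_path[of "\<lambda>xs. ?\<phi> xs * (2 * p xs - 1)"])
  finally show ?thesis .
qed

lemma measurable_pos_process: "pos \<in> measurable iid_unif (PiM UNIV (\<lambda>_. count_space UNIV))"
  by (rule measurable_PiM_single') (simp_all add: space_PiM)

end

locale two_driven_walks = H: driven_walk p h + H': driven_walk p h'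
  for p :: "int list \<Rightarrow> real" and h :: "int list \<Rightarrow> 'i" and h' :: "int list \<Rightarrow> 'j"
begin

lemma prob_path_eq: "iid_unif.prob {V. H.path V n = xs} = iid_unif.prob {V. H'.path V n = xs}"
proof (induction n arbitrary: xs)
  case (Suc n)
  show ?case
  proof (cases xs rule: rev_cases)
    case (snoc ys z)
    then show ?thesis
      using Suc.IH by (simp only: H.prob_path_snoc H'.prob_path_snoc)
  qed simp
qed simp

lemma distr_path_eq:
  "distr iid_unif (count_space UNIV) (\<lambda>V. H.path V n) = distr iid_unif (count_space UNIV) (\<lambda>V. H'.path V n)"
proof (rule measure_eqI_countable[of _ UNIV])
  fix xs
  show "emeasure (distr iid_unif (count_space UNIV) (\<lambda>V. H.path V n)) {xs} =
      emeasure (distr iid_unif (count_space UNIV) (\<lambda>V. H'.path V n)) {xs}"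
    using prob_path_eq by (simp add: emeasure_distr vimage_def iid_unif.emeasure_eq_measure)
qed simp_all

lemma distr_pos_eq:
  "distr iid_unif (PiM UNIV (\<lambda>_. count_space UNIV)) H.pos =
   distr iid_unif (PiM UNIV (\<lambda>_. count_space UNIV)) H'.pos"
proof (rule measure_eqI_PiM_infinite)
  let ?N = "PiM UNIV (\<lambda>_::nat. count_space (UNIV :: int set))"
  fix A :: "nat \<Rightarrow> int set" and J :: "nat set"
  assume finite_J: "finite J"
  obtain n where J_le_n: "\<forall>j\<in>J. j \<le> n"
    using finite_J finite_nat_set_iff_bounded_le by blast
  define C where "C = prod_emb UNIV (\<lambda>_::nat. count_space (UNIV :: int set)) J (Pi\<^sub>E J A)"
  define B where "B = {xs::int list. \<forall>j\<in>J. xs ! j \<in> A j}"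
  have C_sets: "C \<in> sets ?N"
    unfolding C_def using finite_J by (intro sets_PiM_I_finite measurable_prod_emb) (auto intro: sets_PiM_I_finite)
  have "H.pos -` C = (\<lambda>V. H.path V n) -` B" "H'.pos -` C = (\<lambda>V. H'.path V n) -` B"
    using J_le_n by (auto simp: C_def prod_emb_def B_def H.path_nth H'.path_nth PiE_iff)
  moreover have "emeasure iid_unif ((\<lambda>V. H.path V n) -` B) = emeasure iid_unif ((\<lambda>V. H'.path V n) -` B)"
    using arg_cong[OF distr_path_eq[of n], of "\<lambda>M. emeasure M B"] by (simp add: emeasure_distr)
  ultimately show "emeasure (distr iid_unif ?N H.pos) C = emeasure (distr iid_unif ?N H'.pos) C"
    using C_sets by (simp add: emeasure_distr H.measurable_pos_process H'.measurable_pos_process)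
next
  interpret D: prob_space "distr iid_unif (PiM UNIV (\<lambda>_. count_space UNIV)) H.pos"
    by (rule iid_unif.prob_space_distr) (rule H.measurable_pos_process)
  show "finite_measure (distr iid_unif (PiM UNIV (\<lambda>_. count_space UNIV)) H.pos)"
    by (rule D.finite_measure_axioms)
qed simp_all

lemma AE_recurrent_iff:
  "(AE V in iid_unif. recurrent_path (H.pos V)) \<longleftrightarrow> (AE V in iid_unif. recurrent_path (H'.pos V))"
proof -
  let ?N = "PiM UNIV (\<lambda>_::nat. count_space (UNIV :: int set))"
  have rec: "{X \<in> space ?N. recurrent_path X} \<in> sets ?N"
    unfolding recurrent_path_def infinite_nat_iff_unbounded_le mem_Collect_eq by measurable
  show ?thesis
    using AE_distr_iff[OF H.measurable_pos_process rec] AE_distr_iff[OF H'.measurable_pos_process rec]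
    unfolding distr_pos_eq by blast
qed

end

section \<open>Reinforced walks as stacks of urns\<close>

lemma urn_alpha_eq:
  assumes "0 < l"
  shows "urn_alpha f a l U k =
    (a * l + real (count_below (\<lambda>j. U j < f (urn_alpha f a l U j)) k)) / (l + real k)"
proof (induction k)
  case 0
  then show ?case using assms by simp
next
  case (Suc k)
  have "l + real k > 0" using assms by simp
  then have "(l + real k) * urn_alpha f a l U k =
      a * l + real (count_below (\<lambda>j. U j < f (urn_alpha f a l U j)) k)"
    by (subst Suc.IH) simp
  then show ?case
    by (simp add: Let_def count_below_Suc add_ac)
qed

lemma env_alpha_eq:
  "env_alpha a0 l0 xs x =
    (a0 x * l0 x + real (steps_before (nth xs) (length xs - 1) x (x + 1))) /
    (l0 x + real (visits_before (nth xs) (length xs - 1) x))"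
  by (simp add: env_alpha_def steps_before_def visits_before_def count_below_def Let_def)

lemma steps_before_le_visits_before: "steps_before X n x y \<le> visits_before X n x"
  by (induction n) (auto simp: steps_before_Suc visits_before_Suc)

locale grrw_env =
  fixes f :: "real \<Rightarrow> real" and a0 l0 :: "int \<Rightarrow> real"
  assumes cont_f: "continuous_on {0..1} f"
    and f_pos: "y \<in> {0..1} \<Longrightarrow> 0 < f y"
    and f_less_1: "y \<in> {0..1} \<Longrightarrow> f y < 1"
    and a0_nonneg: "0 \<le> a0 x" and a0_le_1: "a0 x \<le> 1" and l0_pos: "0 < l0 x"
begin

definition urn_composition :: "int \<Rightarrow> nat \<Rightarrow> nat \<Rightarrow> real" where
  "urn_composition x m n = (a0 x * l0 x + real m) / (l0 x + real n)"

definition up_prob :: "int list \<Rightarrow> real" where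
  "up_prob xs = f (env_alpha a0 l0 xs (last xs))"

definition stack_index :: "int list \<Rightarrow> int \<times> nat" where
  "stack_index xs = (last xs, visits_before (nth xs) (length xs - 1) (last xs))"

definition stack_alpha :: "(int \<times> nat \<Rightarrow> real) \<Rightarrow> int \<Rightarrow> nat \<Rightarrow> real" where
  "stack_alpha V x j = urn_alpha f (a0 x) (l0 x) (\<lambda>i. V (x, i)) j"

definition arrow :: "(int \<times> nat \<Rightarrow> real) \<Rightarrow> int \<Rightarrow> nat \<Rightarrow> bool" where
  "arrow V x j \<longleftrightarrow> V (x, j) < f (stack_alpha V x j)"

definition drift :: "(int \<times> nat \<Rightarrow> real) \<Rightarrow> int \<Rightarrow> nat \<Rightarrow> real" where
  "drift V x j = 2 * f (stack_alpha V x j) - 1"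

lemma a0_l0_nonneg: "0 \<le> a0 x * l0 x" and a0_l0_le: "a0 x * l0 x \<le> l0 x"
  using a0_nonneg[of x] a0_le_1[of x] l0_pos[of x] by (simp_all add: mult_le_cancel_right1)

lemma urn_composition_in_unit:
  assumes "m \<le> n"
  shows "urn_composition x m n \<in> {0..1}"
proof -
  have "0 \<le> a0 x * l0 x + real m" "a0 x * l0 x + real m \<le> l0 x + real n"
    using a0_l0_nonneg[of x] a0_l0_le[of x] assms by simp_all
  then show ?thesis
    using l0_pos[of x] by (simp add: urn_composition_def)
qed

lemma up_prob_pos: "0 < up_prob xs" and up_prob_less_1: "up_prob xs < 1"
  using f_pos f_less_1 urn_composition_in_unit[OF steps_before_le_visits_before]
  by (auto simp: up_prob_def env_alpha_eq simp flip: urn_composition_def)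

sublocale time_driven: driven_walk up_prob "\<lambda>xs. length xs - 1"
  by unfold_locales (use up_prob_pos up_prob_less_1 in \<open>auto intro: less_imp_le\<close>)

sublocale stack_driven: driven_walk up_prob stack_index
proof
  fix k and xs :: "int list"
  assume k_less: "Suc k < length xs"
  have "stack_index (take (Suc k) xs) = (xs ! k, visits_before (nth xs) k (xs ! k))"
  proof -
    have "last (take (Suc k) xs) = xs ! k"
      using k_less by (simp add: take_Suc_conv_app_nth)
    moreover have "visits_before (nth (take (Suc k) xs)) k x = visits_before (nth xs) k x" for x
      unfolding visits_before_def by (rule count_below_cong) simp
    ultimately show ?thesis
      using k_less by (simp add: stack_index_def)
  qed
  moreover have "visits_before (nth xs) k (last xs) < visits_before (nth xs) (length xs - 1) (last xs)"
    if "xs ! k = last xs"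
  proof -
    have "visits_before (nth xs) (Suc k) (last xs) \<le> visits_before (nth xs) (length xs - 1) (last xs)"
      unfolding visits_before_def using k_less by (intro count_below_mono) simp
    then show ?thesis
      using that by (simp add: visits_before_Suc)
  qed
  ultimately show "stack_index (take (Suc k) xs) \<noteq> stack_index xs"
    by (auto simp: stack_index_def)
qed (use up_prob_pos up_prob_less_1 in \<open>auto intro: less_imp_le\<close>)

abbreviation path :: "(int \<times> nat \<Rightarrow> real) \<Rightarrow> nat \<Rightarrow> int list" where
  "path \<equiv> stack_driven.path"

abbreviation pos :: "(int \<times> nat \<Rightarrow> real) \<Rightarrow> nat \<Rightarrow> int" where
  "pos \<equiv> stack_driven.pos"

sublocale two_driven_walks up_prob "\<lambda>xs. length xs - 1" stack_index ..

lemma grrw_eq_time_driven: "grrw f a0 l0 U = time_driven.pos U"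
proof
  fix n
  have "grrw_path f a0 l0 U n = time_driven.path U n" for n
    by (induction n) (simp_all add: Let_def del: One_nat_def flip: up_prob_def)
  then show "grrw f a0 l0 U n = time_driven.pos U n"
    by (simp add: grrw_def time_driven.pos_def del: One_nat_def)
qed

lemma AE_recurrent_grrw_iff:
  "(AE U in unif_seq. recurrent_path (grrw f a0 l0 U)) \<longleftrightarrow> (AE V in iid_unif. recurrent_path (pos V))"
  unfolding grrw_eq_time_driven unif_seq_eq_iid_unif by (rule AE_recurrent_iff)

lemma stack_alpha_eq: "stack_alpha V x k = urn_composition x (count_below (arrow V x) k) k"
  unfolding stack_alpha_def arrow_def urn_composition_def using l0_pos by (rule urn_alpha_eq)

lemma stack_alpha_in_unit: "stack_alpha V x k \<in> {0..1}"
  unfolding stack_alpha_eq by (rule urn_composition_in_unit) (rule count_below_le)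

lemma visits_before_path: "visits_before (nth (path V n)) n x = visits_before (pos V) n x"
  unfolding visits_before_def by (rule count_below_cong) (simp add: stack_driven.path_nth)

lemma steps_before_path: "steps_before (nth (path V n)) n x y = steps_before (pos V) n x y"
  unfolding steps_before_def by (rule count_below_cong) (simp add: stack_driven.path_nth)

lemma stack_index_path: "stack_index (path V n) = (pos V n, visits_before (pos V) n (pos V n))"
  by (simp add: stack_index_def visits_before_path flip: stack_driven.pos_def)

lemma up_prob_path_eq_composition:
  "up_prob (path V n) =
    f (urn_composition (pos V n) (steps_before (pos V) n (pos V n) (pos V n + 1))
      (visits_before (pos V) n (pos V n)))"
  by (simp add: up_prob_def env_alpha_eq urn_composition_def visits_before_path steps_before_path
      flip: stack_driven.pos_def)

lemma ups_before_pos: "steps_before (pos V) n x (x + 1) = count_below (arrow V x) (visits_before (pos V) n x)"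
proof (induction n arbitrary: x)
  case (Suc n)
  let ?x = "pos V n"
  have "pos V (Suc n) = ?x + 1 \<longleftrightarrow> arrow V ?x (visits_before (pos V) n ?x)"
    by (simp add: stack_driven.pos_Suc stack_index_path up_prob_path_eq_composition Suc.IH
        flip: stack_alpha_eq arrow_def)
  then show ?case
    by (auto simp: steps_before_Suc visits_before_Suc count_below_Suc Suc.IH)
qed simp

lemma up_prob_path: "up_prob (path V n) = f (stack_alpha V (pos V n) (visits_before (pos V) n (pos V n)))"
  by (simp add: up_prob_path_eq_composition ups_before_pos stack_alpha_eq)

sublocale stack_walk "arrow V" "pos V" for V
  by unfold_locales (simp_all add: stack_driven.pos_Suc up_prob_path stack_index_path arrow_def)

lemma exit_drift_eq:
  "stack_driven.exit_drift V G n =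
    (\<Sum>i<n. of_bool (stays_in (pos V) G i) * drift V (pos V i) (visits_before (pos V) i (pos V i)))"
  by (simp add: stack_driven.exit_drift_def up_prob_path drift_def)

text \<open>Nothing is known about \<open>f\<close> outside the unit interval, so \<open>f\<close> itself need not be measurable.\<close>

lemma f_clamp_measurable: "(\<lambda>y. f (max 0 (min 1 y))) \<in> borel_measurable borel"
  by (intro borel_measurable_continuous_onI continuous_on_compose2[OF cont_f] continuous_intros) auto

lemma f_measurable_compose:
  assumes [measurable]: "g \<in> borel_measurable M" and "\<And>x. g x \<in> {0..1}"
  shows "(\<lambda>x. f (g x)) \<in> borel_measurable M"
proof -
  note [measurable] = f_clamp_measurable
  have "f (g x) = f (max 0 (min 1 (g x)))" for x
    using assms(2)[of x] by simp
  then show ?thesis by simp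
qed

lemma stack_alpha_measurable [measurable]: "(\<lambda>V. stack_alpha V x k) \<in> borel_measurable iid_unif"
proof (induction k)
  case 0
  then show ?case by (simp add: stack_alpha_def)
next
  case (Suc k)
  note [measurable] = Suc f_measurable_compose[OF Suc stack_alpha_in_unit]
  show ?case
    unfolding stack_alpha_def urn_alpha.simps Let_def by (fold stack_alpha_def) measurable
qed

lemma f_stack_alpha_measurable [measurable]: "(\<lambda>V. f (stack_alpha V x k)) \<in> borel_measurable iid_unif"
  by (rule f_measurable_compose[OF stack_alpha_measurable stack_alpha_in_unit])

lemma drift_measurable [measurable]: "(\<lambda>V. drift V x k) \<in> borel_measurable iid_unif"
  unfolding drift_def by measurable

lemma arrow_measurable [measurable]: "Measurable.pred iid_unif (\<lambda>V. arrow V x k)"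
  unfolding arrow_def by measurable

lemma cross_count_measurable [measurable]:
  "(\<lambda>V. cross_count (arrow V) j x) \<in> measurable iid_unif (count_space UNIV)"
  by (induction j arbitrary: x) (simp_all add: downs_before_up_def count_below_def)

lemma never_crossed_back_measurable [measurable]:
  "Measurable.pred iid_unif (\<lambda>V. never_crossed_back (arrow V) x)"
  unfolding never_crossed_back_def by measurable

lemma direct_to_measurable [measurable]: "Measurable.pred iid_unif (\<lambda>V. direct_to (arrow V) m)"
  unfolding direct_to_def by measurable

lemma stays_in_measurable [measurable]: "Measurable.pred iid_unif (\<lambda>V. stays_in (pos V) G n)"
  unfolding stays_in_def image_subset_iff by measurable

lemma depends_on_stack_alpha: "depends_on ({x} \<times> UNIV) (\<lambda>V. stack_alpha V x)"
proof (rule depends_onI)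
  fix V W :: "int \<times> nat \<Rightarrow> real"
  assume "\<And>i. i \<in> {x} \<times> UNIV \<Longrightarrow> V i = W i"
  then have "(\<lambda>i. V (x, i)) = (\<lambda>i. W (x, i))"
    by simp
  then show "stack_alpha V x = stack_alpha W x"
    by (simp add: stack_alpha_def fun_eq_iff)
qed

lemma depends_on_arrow: "depends_on ({x} \<times> UNIV) (\<lambda>V. arrow V x)"
proof (rule depends_onI)
  fix V W :: "int \<times> nat \<Rightarrow> real"
  assume agree: "\<And>i. i \<in> {x} \<times> UNIV \<Longrightarrow> V i = W i"
  then have "stack_alpha V x = stack_alpha W x"
    by (rule depends_onD[OF depends_on_stack_alpha])
  with agree show "arrow V x = arrow W x"
    by (simp add: arrow_def fun_eq_iff)
qed

lemma depends_on_drift: "depends_on ({x} \<times> UNIV) (\<lambda>V. drift V x)"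
  using depends_on_compose[OF depends_on_stack_alpha, of x "\<lambda>\<alpha> j. 2 * f (\<alpha> j) - 1"]
  by (simp add: drift_def[abs_def])

lemma depends_on_cross_count: "depends_on ({x<..x + int j} \<times> UNIV) (\<lambda>V. cross_count (arrow V) j x)"
proof (intro depends_onI cross_count_cong)
  fix V W :: "int \<times> nat \<Rightarrow> real" and z
  assume "\<And>i. i \<in> {x<..x + int j} \<times> UNIV \<Longrightarrow> V i = W i" "x < z" "z \<le> x + int j"
  then show "arrow V z = arrow W z"
    by (intro depends_onD[OF depends_on_arrow]) auto
qed

lemma depends_on_cross_counts: "depends_on ({x<..} \<times> UNIV) (\<lambda>V j. cross_count (arrow V) j x)"
proof (intro depends_onI ext)
  fix V W :: "int \<times> nat \<Rightarrow> real" and j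
  assume "\<And>i. i \<in> {x<..} \<times> UNIV \<Longrightarrow> V i = W i"
  then show "cross_count (arrow V) j x = cross_count (arrow W) j x"
    by (intro depends_onD[OF depends_on_cross_count]) auto
qed

lemma depends_on_never_crossed_back: "depends_on ({x<..} \<times> UNIV) (\<lambda>V. never_crossed_back (arrow V) x)"
  unfolding never_crossed_back_def
  by (rule depends_on_compose[OF depends_on_cross_counts, of _ "\<lambda>c. \<forall>j. c j = 0"])

lemma depends_on_direct_to: "depends_on ({..int m} \<times> UNIV) (\<lambda>V. direct_to (arrow V) m)"
proof (rule depends_onI)
  fix V W :: "int \<times> nat \<Rightarrow> real"
  assume agree: "\<And>i. i \<in> {..int m} \<times> UNIV \<Longrightarrow> V i = W i"
  have "arrow V 0 = arrow W 0"
    by (rule depends_onD[OF depends_on_arrow]) (use agree in auto)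
  moreover have "cross_count (arrow V) m 0 = cross_count (arrow W) m 0"
    by (rule depends_onD[OF depends_on_cross_count]) (use agree in auto)
  ultimately show "direct_to (arrow V) m = direct_to (arrow W) m"
    by (simp add: direct_to_def)
qed

lemma arrow_pattern_iff:
  "(\<forall>i<n. arrow V x i = b i) \<longleftrightarrow> (\<forall>i<n. (V (x, i) < f (urn_composition x (count_below b i) i)) = b i)"
proof (induction n)
  case (Suc n)
  have "arrow V x n \<longleftrightarrow> V (x, n) < f (urn_composition x (count_below b n) n)" if "\<forall>i<n. arrow V x i = b i"
    using that count_below_cong[of n "arrow V x" b] by (simp add: arrow_def stack_alpha_eq)
  with Suc show ?case
    unfolding All_less_Suc by blast
qed simp

lemma prob_arrow_pattern_pos: "0 < iid_unif.prob {V. \<forall>i<n. arrow V x i = b i}"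
proof -
  define c where "c i = f (urn_composition x (count_below b i) i)" for i
  have c_bounds: "0 < c i" "c i < 1" for i
    using f_pos f_less_1 urn_composition_in_unit[OF count_below_le] by (auto simp: c_def)
  have "iid_unif.prob {V. \<forall>i<n. arrow V x i = b i} = (\<Prod>i<n. if b i then c i else 1 - c i)"
    unfolding arrow_pattern_iff c_def[symmetric]
    using c_bounds by (intro prob_iid_unif_all_less_iff) (auto simp: inj_on_def intro: less_imp_le)
  then show ?thesis
    using c_bounds by (auto intro!: prod_pos)
qed

lemma abs_urn_composition_diff_le:
  assumes y_unit: "y \<in> {0..1}" and m_bounds: "y * real n \<le> real m" "real m \<le> y * real n + 1"
  shows "\<bar>urn_composition x m (Suc n) - y\<bar> \<le> (l0 x + 2) / (l0 x + real (Suc n))"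
proof -
  have pos: "0 < l0 x + real (Suc n)"
    using l0_pos[of x] by simp
  have "0 \<le> y * l0 x" "y * l0 x \<le> l0 x"
    using y_unit l0_pos[of x] by (simp_all add: mult_le_cancel_right1)
  moreover have "y * (l0 x + real (Suc n)) = y * l0 x + y * real n + y"
    by (simp add: algebra_simps)
  ultimately have "\<bar>a0 x * l0 x + real m - y * (l0 x + real (Suc n))\<bar> \<le> l0 x + 2"
    using a0_l0_nonneg[of x] a0_l0_le[of x] y_unit m_bounds unfolding abs_le_iff atLeastAtMost_iff by linarith
  moreover have "urn_composition x m (Suc n) - y =
      (a0 x * l0 x + real m - y * (l0 x + real (Suc n))) / (l0 x + real (Suc n))"
    using pos by (simp add: urn_composition_def field_simps)
  ultimately show ?thesis
    using pos by (simp add: divide_right_mono)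
qed

lemma urn_composition_dense:
  assumes "y \<in> {0..1}"
  obtains m where "\<And>n. 1 \<le> m n" "\<And>n. m n \<le> Suc n" "(\<lambda>n. urn_composition x (m n) (Suc n)) \<longlonglongrightarrow> y"
proof
  define m where "m n = Suc (nat \<lfloor>y * real n\<rfloor>)" for n
  show "1 \<le> m n" for n
    by (simp add: m_def)
  show "m n \<le> Suc n" for n
  proof -
    have "y * real n \<le> real n"
      using assms by (simp add: mult_left_le_one_le)
    then show ?thesis
      by (simp add: m_def floor_le_iff nat_le_iff)
  qed
  have "y * real n \<le> real (m n)" "real (m n) \<le> y * real n + 1" for n
    using assms by (simp_all add: m_def of_nat_nat floor_le_iff, linarith)
  then have bound: "norm (urn_composition x (m n) (Suc n) - y) \<le> (l0 x + 2) / (l0 x + real (Suc n))" for n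
    using abs_urn_composition_diff_le[OF assms] by simp
  have "(\<lambda>n. (l0 x + 2) / (l0 x + real (Suc n))) \<longlonglongrightarrow> 0"
    by (intro tendsto_divide_0[OF tendsto_const] filterlim_at_top_imp_at_infinity
        filterlim_tendsto_add_at_top[OF tendsto_const]
        filterlim_compose[OF filterlim_real_sequentially filterlim_Suc])
  then have "(\<lambda>n. urn_composition x (m n) (Suc n) - y) \<longlonglongrightarrow> 0"
    by (rule Lim_null_comparison[OF always_eventually[OF allI[OF bound]]])
  then show "(\<lambda>n. urn_composition x (m n) (Suc n)) \<longlonglongrightarrow> y"
    by (rule LIM_zero_cancel)
qed

lemma ex_urn_composition_f_greater:
  assumes y_unit: "y \<in> {0..1}" and c_less: "c < f y"
  shows "\<exists>m n. 1 \<le> m \<and> m \<le> n \<and> c < f (urn_composition x m n)"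
proof -
  obtain m where m_dense: "\<And>n. 1 \<le> m n" "\<And>n. m n \<le> Suc n" "(\<lambda>n. urn_composition x (m n) (Suc n)) \<longlonglongrightarrow> y"
    using urn_composition_dense[OF y_unit] by blast
  have "(\<lambda>n. f (urn_composition x (m n) (Suc n))) \<longlonglongrightarrow> f y"
    using y_unit m_dense(2) urn_composition_in_unit by (intro continuous_on_tendsto_compose[OF cont_f m_dense(3)]) auto
  then have "\<forall>\<^sub>F n in sequentially. c < f (urn_composition x (m n) (Suc n))"
    by (rule order_tendstoD(1)) (rule c_less)
  then obtain n where "c < f (urn_composition x (m n) (Suc n))"
    by (auto simp: eventually_sequentially)
  with m_dense(1,2)[of n] show ?thesis by blast
qed

lemma f_bounded_away:
  obtains c d where "0 < c" "c \<le> 1" "0 \<le> d" "d < 1" "\<And>y. y \<in> {0..1} \<Longrightarrow> c \<le> f y" "\<And>y. y \<in> {0..1} \<Longrightarrow> f y \<le> d"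
proof -
  obtain y where f_max: "y \<in> {0..1}" "\<forall>z\<in>{0..1}. f z \<le> f y"
    using continuous_attains_sup[of "{0..1::real}" f] cont_f by auto
  obtain y' where f_min: "y' \<in> {0..1}" "\<forall>z\<in>{0..1}. f y' \<le> f z"
    using continuous_attains_inf[of "{0..1::real}" f] cont_f by auto
  show ?thesis
    using that[of "f y'" "f y"] f_max f_min f_pos f_less_1 by (force intro: less_imp_le)
qed

lemma AE_full_stack: "AE V in iid_unif. full_stack_walk (arrow V) (pos V)"
proof -
  obtain c d where c_unit: "0 < c" "c \<le> 1" and d_unit: "0 \<le> d" "d < 1"
    and f_ge: "\<And>y. y \<in> {0..1} \<Longrightarrow> c \<le> f y" and f_le: "\<And>y. y \<in> {0..1} \<Longrightarrow> f y \<le> d"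
    using f_bounded_away by blast
  have "AE V in iid_unif. infinite {k::nat. (V (x, k) < c) = True}"
    "AE V in iid_unif. infinite {k::nat. (V (x, k) < d) = False}" for x :: int
    using c_unit d_unit by (intro AE_iid_unif_infinitely_often_less_iff; simp add: inj_def)+
  then have "AE V in iid_unif. \<forall>x::int. infinite {k::nat. (V (x, k) < c) = True}"
    "AE V in iid_unif. \<forall>x::int. infinite {k::nat. (V (x, k) < d) = False}"
    unfolding AE_all_countable by blast+
  then show ?thesis
  proof eventually_elim
    case (elim V)
    show ?case
    proof
      fix x
      have "{k. (V (x, k) < c) = True} \<subseteq> {k. arrow V x k}"
        using f_ge[OF stack_alpha_in_unit] by (auto simp: arrow_def intro: less_le_trans)
      then show "infinite {k. arrow V x k}"
        by (rule infinite_super) (use elim in blast)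
      have "{k. (V (x, k) < d) = False} \<subseteq> {k. \<not> arrow V x k}"
        using f_le[OF stack_alpha_in_unit] by (auto simp: arrow_def dest: less_le_trans)
      then show "infinite {k. \<not> arrow V x k}"
        by (rule infinite_super) (use elim in blast)
    qed
  qed
qed

end

section \<open>Walks with nonnegative drift\<close>

locale nonneg_drift_grrw = grrw_env +
  assumes f_ge_half: "y \<in> {0..1} \<Longrightarrow> 1/2 \<le> f y"
begin

lemma drift_nonneg: "0 \<le> drift V x j"
  using f_ge_half[OF stack_alpha_in_unit[of V x j]] by (simp add: drift_def)

lemma drift_less_1: "drift V x j < 1"
  using f_less_1[OF stack_alpha_in_unit[of V x j]] by (simp add: drift_def)

lemma exit_drift_nonneg: "0 \<le> stack_driven.exit_drift V G n"
  unfolding exit_drift_eq by (intro sum_nonneg) (simp add: drift_nonneg)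

lemma incseq_exit_drift: "incseq (stack_driven.exit_drift V G)"
  unfolding exit_drift_eq by (intro monoI sum_mono2) (auto simp: drift_nonneg)

lemma integral_exit_gain_nonneg: "0 \<le> (\<integral>V. exit_gain (pos V) G n \<partial>iid_unif)"
  unfolding stack_driven.integral_exit_gain by (intro integral_nonneg_AE AE_I2 exit_drift_nonneg)

lemma integral_exit_drift_below_le:
  assumes "0 < k"
  shows "(\<integral>V. stack_driven.exit_drift V {..<k} n \<partial>iid_unif) \<le> of_int k"
proof -
  have "(\<integral>V. exit_gain (pos V) {..<k} n \<partial>iid_unif) \<le>
      (\<integral>V. of_int k \<partial>(iid_unif :: (int \<times> nat \<Rightarrow> real) measure))"
    using exit_gain_below_le[OF assms] by (intro integral_mono stack_driven.integrable_exit_gain) auto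
  then show ?thesis
    by (simp add: stack_driven.integral_exit_gain)
qed

lemma prob_far_left_before_level:
  assumes "0 < k"
  shows "iid_unif.prob {V. stays_in (pos V) {..<k} n \<and> pos V n < - int m} \<le> of_int k / (of_int k + real m)"
proof -
  define B where "B = {V. stays_in (pos V) {..<k} n \<and> pos V n < - int m}"
  have [measurable]: "B \<in> sets iid_unif"
    unfolding B_def by measurable
  have "(of_int k + real m) * iid_unif.prob B = (\<integral>V. (of_int k + real m) * indicator B V \<partial>iid_unif)"
    by simp
  also have "\<dots> \<le> (\<integral>V. of_int k - exit_gain (pos V) {..<k} n \<partial>iid_unif)"
  proof (rule integral_mono)
    fix V
    show "(of_int k + real m) * indicator B V \<le> of_int k - exit_gain (pos V) {..<k} n"
      using exit_gain_below_le[OF assms] exit_gain_if_stays_in[of V "{..<k}" n]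
      by (auto simp: B_def indicator_def)
  qed (use stack_driven.integrable_exit_gain in \<open>auto simp: iid_unif.emeasure_eq_measure\<close>)
  also have "\<dots> \<le> of_int k"
    using stack_driven.integrable_exit_gain integral_exit_gain_nonneg by simp
  finally show ?thesis
    using assms by (simp add: B_def field_simps)
qed

lemma prob_misses_level_le:
  assumes "0 < k"
  shows "iid_unif.prob {V. \<forall>n. pos V n \<noteq> k} \<le> of_int k / (of_int k + real m)"
proof (rule LIMSEQ_le_const2)
  define B where "B = {V. \<forall>n. pos V n \<noteq> k}"
  have [measurable]: "B \<in> sets iid_unif"
    unfolding B_def by measurable
  show "(\<lambda>n. iid_unif.prob (B \<inter> {V. pos V n < - int m})) \<longlonglongrightarrow> iid_unif.prob {V. \<forall>n. pos V n \<noteq> k}"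
    unfolding B_def[symmetric]
  proof (rule iid_unif.measure_tendsto_if_AE_eventually)
    show "AE V in iid_unif. \<forall>\<^sub>F n in sequentially. V \<in> B \<inter> {V. pos V n < - int m} \<longleftrightarrow> V \<in> B"
      using AE_full_stack
    proof eventually_elim
      case (elim V)
      interpret full_stack_walk "arrow V" "pos V" by fact
      show ?case
      proof (cases "V \<in> B")
        case True
        then show ?thesis
          using escapes_left[of k m] assms by (simp add: B_def)
      qed simp
    qed
  qed measurable
  have "stays_in (pos V) {..<k} n" if "V \<in> B" for V n
    using X_less_if_not_hit[of _ V k] that assms by (auto simp: B_def stays_in_def)
  then have "iid_unif.prob (B \<inter> {V. pos V n < - int m}) \<le>
      iid_unif.prob {V. stays_in (pos V) {..<k} n \<and> pos V n < - int m}" for n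
    by (intro iid_unif.finite_measure_mono) auto
  then show "\<exists>N. \<forall>n\<ge>N. iid_unif.prob (B \<inter> {V. pos V n < - int m}) \<le> of_int k / (of_int k + real m)"
    using prob_far_left_before_level[OF assms, of _ m] order_trans by blast
qed

lemma AE_hits_level:
  assumes "0 < k"
  shows "AE V in iid_unif. \<exists>n. pos V n = k"
proof -
  have "(\<lambda>m. of_int k / (of_int k + real m)) \<longlonglongrightarrow> 0"
    by (intro tendsto_divide_0[OF tendsto_const] filterlim_at_top_imp_at_infinity
        filterlim_tendsto_add_at_top[OF tendsto_const] filterlim_real_sequentially)
  then have "iid_unif.prob {V. \<forall>n. pos V n \<noteq> k} \<le> 0"
    using prob_misses_level_le[OF assms]
    by (intro LIMSEQ_le_const[of "\<lambda>m. of_int k / (of_int k + real m)"]) auto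
  moreover have "{V. \<forall>n. pos V n \<noteq> k} \<in> sets iid_unif"
    by measurable
  ultimately show ?thesis
    using iid_unif.prob_eq_0[of "{V. \<forall>n. pos V n \<noteq> k}"] by (simp add: measure_le_0_iff)
qed

lemma AE_right_reaching: "AE V in iid_unif. right_reaching_stack_walk (arrow V) (pos V)"
proof -
  have "AE V in iid_unif. 0 < k \<longrightarrow> (\<exists>n. pos V n = k)" for k
    using AE_hits_level[of k] by (cases "0 < k") auto
  then have "AE V in iid_unif. \<forall>k. 0 < k \<longrightarrow> (\<exists>n. pos V n = k)"
    by (simp add: AE_all_countable)
  then show ?thesis
  proof eventually_elim
    case (elim V)
    have "\<exists>n. pos V n = k" if "0 \<le> k" for k
      using elim that by (cases "k = 0") (auto intro: exI[of _ 0])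
    then show ?case
      by unfold_locales
  qed
qed

definition total_drift :: "(int \<times> nat \<Rightarrow> real) \<Rightarrow> int \<Rightarrow> ennreal" where
  "total_drift V x = (\<Sum>i. ennreal (drift V x i))"

definition later_drift :: "(int \<times> nat \<Rightarrow> real) \<Rightarrow> int \<Rightarrow> ennreal" where
  "later_drift V x = (\<Sum>i. ennreal (drift V x (Suc i)))"

lemma total_drift_split: "total_drift V x = ennreal (drift V x 0) + later_drift V x"
  using suminf_offset[of "\<lambda>i. ennreal (drift V x i)" 1]
  by (simp add: total_drift_def later_drift_def add.commute)

lemma total_drift_measurable [measurable]: "(\<lambda>V. total_drift V x) \<in> borel_measurable iid_unif"
  unfolding total_drift_def by measurable

lemma later_drift_measurable [measurable]: "(\<lambda>V. later_drift V x) \<in> borel_measurable iid_unif"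
  unfolding later_drift_def by measurable

lemma depends_on_total_drift: "depends_on ({x} \<times> UNIV) (\<lambda>V. total_drift V x)"
  unfolding total_drift_def by (rule depends_on_compose[OF depends_on_drift])

lemma depends_on_later_drift: "depends_on ({x} \<times> UNIV) (\<lambda>V. later_drift V x)"
  unfolding later_drift_def by (rule depends_on_compose[OF depends_on_drift])

lemma sum_drift_le_total_drift: "ennreal (\<Sum>i<n. drift V x i) \<le> total_drift V x"
proof -
  have "ennreal (\<Sum>i<n. drift V x i) = (\<Sum>i<n. ennreal (drift V x i))"
    using drift_nonneg by (simp add: sum_ennreal)
  also have "\<dots> \<le> total_drift V x"
    unfolding total_drift_def by (intro sum_le_suminf summableI) auto
  finally show ?thesis .
qed

lemma later_drift_ge_if_arrow_pattern:
  assumes "\<And>i. i < Suc n \<Longrightarrow> arrow V x i = (i < m)" "m \<le> Suc n"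
  shows "ennreal (2 * f (urn_composition x m (Suc n)) - 1) \<le> later_drift V x"
proof -
  have "count_below (arrow V x) (Suc n) = count_below (\<lambda>i. i < m) (Suc n)"
    using assms(1) by (rule count_below_cong)
  then have "drift V x (Suc n) = 2 * f (urn_composition x m (Suc n)) - 1"
    using assms(2) by (simp add: drift_def stack_alpha_eq count_below_less_eq_min min_absorb1)
  then have "ennreal (2 * f (urn_composition x m (Suc n)) - 1) = (\<Sum>i\<in>{n}. ennreal (drift V x (Suc i)))"
    by simp
  also have "\<dots> \<le> later_drift V x"
    unfolding later_drift_def by (intro sum_le_suminf summableI) auto
  finally show ?thesis .
qed

lemma nn_integral_total_drift_eq_SUP:
  "(\<integral>\<^sup>+V. total_drift V x \<partial>iid_unif) = (SUP n. \<integral>\<^sup>+V. ennreal (\<Sum>i<n. drift V x i) \<partial>iid_unif)"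
proof -
  have "total_drift V x = (SUP n. ennreal (\<Sum>i<n. drift V x i))" for V
    using drift_nonneg by (simp add: total_drift_def suminf_eq_SUP sum_ennreal)
  then show ?thesis
    by (simp only:, intro nn_integral_monotone_convergence_SUP)
       (auto simp: incseq_def le_fun_def drift_nonneg intro!: ennreal_leI sum_mono2)
qed

lemma exit_drift_eq_sum_site_weight:
  assumes "finite S" "insert 0 G \<subseteq> S"
  shows "stack_driven.exit_drift V G n = (\<Sum>x\<in>S. site_weight (drift V) (pos V) G n x)"
proof -
  have "pos V i \<in> S" if "stays_in (pos V) G i" for i
    using assms(2) stays_inD[OF that, of i] by (cases "i = 0") auto
  then show ?thesis
    unfolding exit_drift_eq sum_site_weight[OF assms(1)] by (intro sum.cong) auto
qed

lemma sum_site_weight_le_exit_drift: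
  assumes "finite S"
  shows "(\<Sum>x\<in>S. site_weight (drift V) (pos V) G n x) \<le> stack_driven.exit_drift V G n"
  unfolding exit_drift_eq sum_site_weight[OF assms]
  by (intro sum_mono mult_right_mono) (auto simp: drift_nonneg)

lemma nn_integral_SUP_exit_drift_below_le:
  assumes "0 < k"
  shows "(\<integral>\<^sup>+V. (SUP n. ennreal (stack_driven.exit_drift V {..<k} n)) \<partial>iid_unif) \<le> ennreal (of_int k)"
proof -
  have "(\<integral>\<^sup>+V. (SUP n. ennreal (stack_driven.exit_drift V {..<k} n)) \<partial>iid_unif) =
      (SUP n. \<integral>\<^sup>+V. ennreal (stack_driven.exit_drift V {..<k} n) \<partial>iid_unif)"
    using stack_driven.integrable_exit_drift incseq_exit_drift
    by (intro nn_integral_monotone_convergence_SUP)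
       (auto simp: mono_def le_fun_def intro!: ennreal_leI)
  also have "\<dots> \<le> ennreal (of_int k)"
    using integral_exit_drift_below_le[OF assms]
    by (intro SUP_least)
       (simp add: nn_integral_eq_integral[OF stack_driven.integrable_exit_drift] exit_drift_nonneg ennreal_leI)
  finally show ?thesis .
qed

lemma drift_at_crossed_sites_le_exit_drift:
  assumes "right_reaching_stack_walk (arrow V) (pos V)"
  shows "\<exists>n. (\<Sum>x=1..m. of_bool (N \<le> cross_count (arrow V) (m - x) (int x)) * (\<Sum>i<N. drift V (int x) i))
    \<le> stack_driven.exit_drift V {..<int (Suc m)} n"
proof -
  interpret right_reaching_stack_walk "arrow V" "pos V" by fact
  obtain n where hit_n: "first_hit (pos V) n (int (Suc m))"
    using first_hit_hits[of "int (Suc m)"] by auto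
  let ?w = "site_weight (drift V) (pos V) {..<int (Suc m)} n"
  have "of_bool (N \<le> cross_count (arrow V) (m - x) (int x)) * (\<Sum>i<N. drift V (int x) i) \<le> ?w (int x)"
    if "x \<in> {1..m}" for x
  proof -
    have level: "int x + 1 + int (m - x) = int (Suc m)"
      using that by simp
    show ?thesis
      using site_weight_ge_if_crossed[of "int x" V n "m - x" N "drift V"] hit_n drift_nonneg
      by (auto simp: level site_weight_nonneg)
  qed
  then have "(\<Sum>x=1..m. of_bool (N \<le> cross_count (arrow V) (m - x) (int x)) * (\<Sum>i<N. drift V (int x) i))
      \<le> (\<Sum>x=1..m. ?w (int x))"
    by (rule sum_mono)
  also have "\<dots> = (\<Sum>x\<in>int ` {1..m}. ?w x)"
    by (simp add: sum.reindex)
  also have "\<dots> \<le> stack_driven.exit_drift V {..<int (Suc m)} n"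
    by (rule sum_site_weight_le_exit_drift) simp
  finally show ?thesis by blast
qed

lemma site_weight_le_total_drift: "ennreal (site_weight (drift V) (pos V) G n x) \<le> total_drift V x"
  using ennreal_leI[OF site_weight_le_sum_visits[of "drift V" x "pos V" G n]]
    drift_nonneg sum_drift_le_total_drift
  by (meson order_trans)

lemma site_weight_le_first_drift:
  assumes "right_reaching_stack_walk (arrow V) (pos V)"
    and "0 \<le> x" "arrow V x 0" "never_crossed_back (arrow V) x"
  shows "site_weight (drift V) (pos V) G n x \<le> drift V x 0"
proof -
  interpret right_reaching_stack_walk "arrow V" "pos V" by fact
  have "site_weight (drift V) (pos V) G n x \<le> (\<Sum>i<visits_before (pos V) n x. drift V x i)"
    by (rule site_weight_le_sum_visits) (rule drift_nonneg)
  also have "\<dots> \<le> (\<Sum>i<1. drift V x i)"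
    using visits_before_le_1_if_never_crossed_back[of x n] assms drift_nonneg by (intro sum_mono2) auto
  finally show ?thesis by simp
qed

text \<open>
  On the event that the walk leaves \<open>m + 1\<close> upwards at its first visit and never comes back, at most
  the first of the arrows at \<open>m + 1\<close> is used.
\<close>

lemma site_weight_plus_later_drift_le:
  fixes m :: nat
  assumes "right_reaching_stack_walk (arrow V) (pos V)" "G \<subseteq> {0<..}"
  defines "x \<equiv> int (Suc m)"
  shows "ennreal (site_weight (drift V) (pos V) G n x) +
      of_bool (direct_to (arrow V) m) *
        (of_bool (arrow V x 0) * later_drift V x * of_bool (never_crossed_back (arrow V) x))
    \<le> of_bool (direct_to (arrow V) m) * total_drift V x"
proof -
  consider (undirect) "\<not> direct_to (arrow V) m"
    | (escape) "direct_to (arrow V) m" "arrow V x 0" "never_crossed_back (arrow V) x"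
    | (visited) "direct_to (arrow V) m" "\<not> (arrow V x 0 \<and> never_crossed_back (arrow V) x)"
    by blast
  then show ?thesis
  proof cases
    case undirect
    then show ?thesis
      using site_weight_eq_0_if_not_direct_to[OF undirect assms(2)] by (simp add: x_def)
  next
    case escape
    then have "ennreal (site_weight (drift V) (pos V) G n x) \<le> ennreal (drift V x 0)"
      using site_weight_le_first_drift[OF assms(1)] by (intro ennreal_leI) (simp add: x_def)
    then show ?thesis
      using escape by (simp add: total_drift_split add_right_mono)
  next
    case visited
    then show ?thesis
      using site_weight_le_total_drift by auto
  qed
qed

lemma bounded_cross_count_if_transient:
  assumes "\<not> (AE V in iid_unif. recurrent_path (pos V))"
  obtains N where "0 < iid_unif.prob {V. \<forall>j. cross_count (arrow V) j 0 \<le> N}"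
proof (rule ccontr)
  assume "\<not> thesis"
  then have "iid_unif.prob {V. \<forall>j. cross_count (arrow V) j 0 \<le> N} = 0" for N
    using that[of N] by (auto simp: zero_less_measure_iff)
  then have "AE V in iid_unif. \<not> (\<forall>j. cross_count (arrow V) j 0 \<le> N)" for N
    using iid_unif.prob_eq_0[of "{V. \<forall>j. cross_count (arrow V) j 0 \<le> N}"] by simp
  then have "AE V in iid_unif. \<forall>N. \<not> (\<forall>j. cross_count (arrow V) j 0 \<le> N)"
    unfolding AE_all_countable by blast
  then have "AE V in iid_unif. recurrent_path (pos V)"
    using AE_right_reaching AE_full_stack
  proof eventually_elim
    case (elim V)
    interpret right_reaching_stack_walk "arrow V" "pos V" by fact
    interpret full_stack_walk "arrow V" "pos V" by fact
    have "infinite {n. pos V n = 1}"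
      using cross_count_bounded elim(1) by blast
    then show ?case
      using infinite_all_sites unfolding recurrent_path_def by blast
  qed
  with assms show False by simp
qed

end

section \<open>Homogeneous half-line\<close>

definition shift_site :: "int \<Rightarrow> int \<times> nat \<Rightarrow> int \<times> nat" where
  "shift_site c p = (fst p + c, snd p)"

lemma inj_shift_site: "inj (shift_site c)"
  by (auto simp: inj_def shift_site_def prod_eq_iff)

locale homogeneous_grrw = nonneg_drift_grrw +
  assumes homogeneous: "1 \<le> x \<Longrightarrow> a0 x = a0 1 \<and> l0 x = l0 1"
begin

definition mean_drift :: ennreal where
  "mean_drift = (\<integral>\<^sup>+V. total_drift V 1 \<partial>iid_unif)"

definition mean_initial_drift :: "nat \<Rightarrow> real" where
  "mean_initial_drift n = (\<integral>V. (\<Sum>i<n. drift V 1 i) \<partial>iid_unif)"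

lemma stack_alpha_shift:
  "1 \<le> x \<Longrightarrow> 0 \<le> c \<Longrightarrow> stack_alpha (V \<circ> shift_site c) x = stack_alpha V (x + c)"
  using homogeneous[of x] homogeneous[of "x + c"] by (auto simp: stack_alpha_def shift_site_def)

lemma arrow_shift: "1 \<le> x \<Longrightarrow> 0 \<le> c \<Longrightarrow> arrow (V \<circ> shift_site c) x = arrow V (x + c)"
  by (rule ext) (simp add: arrow_def stack_alpha_shift, simp add: shift_site_def)

lemma drift_shift: "1 \<le> x \<Longrightarrow> 0 \<le> c \<Longrightarrow> drift (V \<circ> shift_site c) x = drift V (x + c)"
  by (rule ext) (simp add: drift_def stack_alpha_shift)

lemma cross_count_arrow_shift:
  assumes "0 \<le> x"
  shows "cross_count (arrow (V \<circ> shift_site x)) j 0 = cross_count (arrow V) j x"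
proof -
  have "cross_count (arrow (V \<circ> shift_site x)) j 0 = cross_count (\<lambda>z. arrow V (z + x)) j 0"
    using assms by (intro cross_count_cong arrow_shift) auto
  also have "\<dots> = cross_count (arrow V) j x"
    by (simp add: cross_count_shift)
  finally show ?thesis .
qed

lemma nn_integral_drift_shift:
  assumes "1 \<le> x" and [measurable]: "(\<lambda>V. h (arrow V 1) (drift V 1)) \<in> borel_measurable iid_unif"
  shows "(\<integral>\<^sup>+V. h (arrow V x) (drift V x) \<partial>iid_unif) = (\<integral>\<^sup>+V. h (arrow V 1) (drift V 1) \<partial>iid_unif)"
  using nn_integral_iid_unif_reindex[OF inj_shift_site assms(2), of "x - 1"] assms(1)
  by (simp add: arrow_shift drift_shift)

lemma prob_cross_count_shift:
  assumes "0 \<le> x" and [measurable]: "Measurable.pred iid_unif (\<lambda>V. P (\<lambda>j. cross_count (arrow V) j 0))"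
  shows "iid_unif.prob {V. P (\<lambda>j. cross_count (arrow V) j x)} =
    iid_unif.prob {V. P (\<lambda>j. cross_count (arrow V) j 0)}"
  using prob_iid_unif_reindex[OF inj_shift_site assms(2), of x]
  by (simp add: cross_count_arrow_shift[OF assms(1)])

lemma integrable_sum_drift: "integrable iid_unif (\<lambda>V. \<Sum>i<n. drift V x i)"
  by (intro Bochner_Integration.integrable_sum iid_unif.integrable_const_bound[where B = 1])
     (auto simp: drift_nonneg intro!: AE_I2 less_imp_le[OF drift_less_1])

lemma mean_initial_drift_nonneg: "0 \<le> mean_initial_drift n"
  unfolding mean_initial_drift_def by (intro integral_nonneg_AE AE_I2 sum_nonneg drift_nonneg)

lemma nn_integral_sum_drift:
  assumes "1 \<le> x"
  shows "(\<integral>\<^sup>+V. ennreal (\<Sum>i<n. drift V x i) \<partial>iid_unif) = ennreal (mean_initial_drift n)"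
proof -
  have "(\<integral>\<^sup>+V. ennreal (\<Sum>i<n. drift V x i) \<partial>iid_unif) = (\<integral>\<^sup>+V. ennreal (\<Sum>i<n. drift V 1 i) \<partial>iid_unif)"
    using nn_integral_drift_shift[OF assms, of "\<lambda>_ d. ennreal (\<Sum>i<n. d i)"] by simp
  also have "\<dots> = ennreal (mean_initial_drift n)"
    unfolding mean_initial_drift_def
    by (intro nn_integral_eq_integral integrable_sum_drift AE_I2 sum_nonneg drift_nonneg)
  finally show ?thesis .
qed

lemma mean_drift_eq_SUP: "mean_drift = (SUP n. ennreal (mean_initial_drift n))"
  by (simp add: mean_drift_def nn_integral_total_drift_eq_SUP nn_integral_sum_drift)

subsection \<open>Recurrent walks\<close>

definition crossing_prob :: "nat \<Rightarrow> nat \<Rightarrow> real" where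
  "crossing_prob N j = iid_unif.prob {V. N \<le> cross_count (arrow V) j 0}"

lemma nn_integral_drift_if_crossed:
  assumes "1 \<le> x"
  shows "(\<integral>\<^sup>+V. ennreal (of_bool (N \<le> cross_count (arrow V) j x) * (\<Sum>i<N. drift V x i)) \<partial>iid_unif) =
    ennreal (crossing_prob N j * mean_initial_drift N)"
proof -
  have "(\<integral>\<^sup>+V. ennreal (of_bool (N \<le> cross_count (arrow V) j x) * (\<Sum>i<N. drift V x i)) \<partial>iid_unif) =
      (\<integral>\<^sup>+V. of_bool (N \<le> cross_count (arrow V) j x) * ennreal (\<Sum>i<N. drift V x i) \<partial>iid_unif)"
    by (intro nn_integral_cong) simp
  also have "\<dots> = (\<integral>\<^sup>+V. of_bool (N \<le> cross_count (arrow V) j x) \<partial>iid_unif) *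
      (\<integral>\<^sup>+V. ennreal (\<Sum>i<N. drift V x i) \<partial>iid_unif)"
    by (rule nn_integral_iid_unif_indep[OF _ _ depends_on_compose[OF depends_on_cross_count]
          depends_on_compose[OF depends_on_drift]]) auto
  also have "\<dots> = ennreal (crossing_prob N j) * ennreal (mean_initial_drift N)"
    using prob_cross_count_shift[of x "\<lambda>c. N \<le> c j"] assms
    by (simp add: iid_unif.nn_integral_of_bool nn_integral_sum_drift crossing_prob_def)
  finally show ?thesis
    by (simp add: ennreal_mult'' mean_initial_drift_nonneg)
qed

lemma sum_crossing_prob_times_mean_drift_le:
  "(\<Sum>j<m. crossing_prob N j) * mean_initial_drift N \<le> real (Suc m)"
proof -
  let ?w = "\<lambda>V x. of_bool (N \<le> cross_count (arrow V) (m - x) (int x)) * (\<Sum>i<N. drift V (int x) i)"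
  have "ennreal ((\<Sum>j<m. crossing_prob N j) * mean_initial_drift N) =
      (\<Sum>j<m. ennreal (crossing_prob N j * mean_initial_drift N))"
    by (subst sum_ennreal) (simp_all add: sum_distrib_right crossing_prob_def mean_initial_drift_nonneg)
  also have "\<dots> = (\<Sum>x=1..m. ennreal (crossing_prob N (m - x) * mean_initial_drift N))"
    by (rule sum.reindex_bij_witness[of _ "\<lambda>x. m - x" "\<lambda>j. m - j"]) auto
  also have "\<dots> = (\<Sum>x=1..m. \<integral>\<^sup>+V. ennreal (?w V x) \<partial>iid_unif)"
    by (intro sum.cong refl nn_integral_drift_if_crossed[symmetric]) simp
  also have "\<dots> = (\<integral>\<^sup>+V. ennreal (\<Sum>x=1..m. ?w V x) \<partial>iid_unif)"
    by (subst nn_integral_sum[symmetric]) (simp_all add: drift_nonneg sum_nonneg)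
  also have "\<dots> \<le> (\<integral>\<^sup>+V. (SUP n. ennreal (stack_driven.exit_drift V {..<int (Suc m)} n)) \<partial>iid_unif)"
  proof (rule nn_integral_mono_AE, use AE_right_reaching in eventually_elim)
    case (elim V)
    then obtain n where "(\<Sum>x=1..m. ?w V x) \<le> stack_driven.exit_drift V {..<int (Suc m)} n"
      using drift_at_crossed_sites_le_exit_drift by blast
    then show ?case
      by (intro SUP_upper2[of n] ennreal_leI) simp_all
  qed
  also have "\<dots> \<le> ennreal (real (Suc m))"
    using nn_integral_SUP_exit_drift_below_le[of "int (Suc m)"] by simp
  finally show ?thesis
    by (subst (asm) ennreal_le_iff) auto
qed

lemma crossing_prob_tendsto_1:
  assumes "AE V in iid_unif. recurrent_path (pos V)"
  shows "crossing_prob N \<longlonglongrightarrow> 1"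
proof -
  have "crossing_prob N \<longlonglongrightarrow> iid_unif.prob (UNIV :: (int \<times> nat \<Rightarrow> real) set)"
    unfolding crossing_prob_def
  proof (rule iid_unif.measure_tendsto_if_AE_eventually)
    show "AE V in iid_unif. \<forall>\<^sub>F j in sequentially. V \<in> {V. N \<le> cross_count (arrow V) j 0} \<longleftrightarrow> V \<in> UNIV"
      using assms AE_right_reaching AE_full_stack
    proof eventually_elim
      case (elim V)
      interpret right_reaching_stack_walk "arrow V" "pos V" by fact
      interpret full_stack_walk "arrow V" "pos V" by fact
      show ?case
        using eventually_cross_count_ge[of N] full_down elim(1) by (simp add: recurrent_path_def)
    qed
  qed (use sets.top[of iid_unif] in auto)
  then show ?thesis by simp
qed

lemma mean_drift_le_1_if_recurrent:
  assumes "AE V in iid_unif. recurrent_path (pos V)"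
  shows "mean_drift \<le> 1"
proof -
  have "mean_initial_drift N \<le> 1" for N
  proof -
    have "(\<lambda>m. (\<Sum>j<m. crossing_prob N j) / real m * mean_initial_drift N) \<longlonglongrightarrow> 1 * mean_initial_drift N"
      by (intro tendsto_mult tendsto_const cesaro_mean_tendsto crossing_prob_tendsto_1 assms)
    moreover have "(\<Sum>j<m. crossing_prob N j) / real m * mean_initial_drift N \<le> real (Suc m) / real m" for m
      using sum_crossing_prob_times_mean_drift_le[of N m] by (simp add: divide_right_mono)
    ultimately have "1 * mean_initial_drift N \<le> 1"
      by (intro LIMSEQ_le[OF _ LIMSEQ_Suc_n_over_n]) auto
    then show ?thesis by simp
  qed
  then show ?thesis
    unfolding mean_drift_eq_SUP by (intro SUP_least) simp
qed

subsection \<open>Transient walks\<close>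

definition mean_later_drift :: ennreal where
  "mean_later_drift = (\<integral>\<^sup>+V. of_bool (arrow V 1 0) * later_drift V 1 \<partial>iid_unif)"

definition escape_prob :: real where
  "escape_prob = iid_unif.prob {V. never_crossed_back (arrow V) 0}"

definition reach_prob :: "nat \<Rightarrow> real" where
  "reach_prob m = iid_unif.prob {V. direct_to (arrow V) m}"

definition net_drift :: real where
  "net_drift = enn2real mean_drift - enn2real mean_later_drift * escape_prob"

lemma mean_later_drift_le: "mean_later_drift \<le> mean_drift"
  unfolding mean_later_drift_def mean_drift_def
  by (intro nn_integral_mono) (simp add: total_drift_split)

lemma ex_f_greater_half_if_mean_drift_pos:
  assumes "0 < mean_drift"
  shows "\<exists>y\<in>{0..1}. 1/2 < f y"
proof (rule ccontr)
  assume "\<not> ?thesis"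
  then have "drift V 1 i = 0" for V i
    using drift_nonneg[of V 1 i] stack_alpha_in_unit[of V 1 i] by (force simp: drift_def)
  then have "mean_drift = 0"
    by (simp add: mean_drift_def total_drift_def)
  with assms show False by simp
qed

lemma mean_later_drift_pos:
  assumes "0 < mean_drift"
  shows "0 < mean_later_drift"
proof -
  obtain y where "y \<in> {0..1}" "1/2 < f y"
    using ex_f_greater_half_if_mean_drift_pos[OF assms] by blast
  then obtain m k where "1 \<le> m" "m \<le> k" "1/2 < f (urn_composition 1 m k)"
    using ex_urn_composition_f_greater[of y "1/2" 1] by blast
  moreover from this obtain n where "k = Suc n"
    by (cases k) auto
  ultimately have reachable: "1 \<le> m" "m \<le> Suc n" "1/2 < f (urn_composition 1 m (Suc n))"
    by auto
  define e where "e = 2 * f (urn_composition 1 m (Suc n)) - 1"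
  define Pat where "Pat = {V. \<forall>i<Suc n. arrow V 1 i = (i < m)}"
  have [measurable]: "Pat \<in> sets iid_unif"
    unfolding Pat_def by measurable
  have "0 < iid_unif.prob Pat"
    unfolding Pat_def by (rule prob_arrow_pattern_pos)
  then have "0 < (\<integral>\<^sup>+V. ennreal e * indicator Pat V \<partial>iid_unif)"
    using reachable(3)
    by (simp add: e_def nn_integral_cmult_indicator ennreal_zero_less_mult_iff iid_unif.emeasure_eq_measure)
  also have "\<dots> \<le> mean_later_drift"
    unfolding mean_later_drift_def
  proof (rule nn_integral_mono)
    fix V
    have "arrow V 1 0" "ennreal e \<le> later_drift V 1" if "V \<in> Pat"
      using that reachable(1) later_drift_ge_if_arrow_pattern[OF _ reachable(2), of V] by (auto simp: Pat_def e_def)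
    then show "ennreal e * indicator Pat V \<le> of_bool (arrow V 1 0) * later_drift V 1"
      by (cases "V \<in> Pat") simp_all
  qed
  finally show ?thesis .
qed

lemma prob_never_crossed_back:
  assumes "0 \<le> x"
  shows "iid_unif.prob {V. never_crossed_back (arrow V) x} = escape_prob"
  using prob_cross_count_shift[OF assms, of "\<lambda>c. \<forall>j. c j = 0"]
  by (simp add: escape_prob_def never_crossed_back_def)

lemma escape_prob_pos:
  assumes "\<not> (AE V in iid_unif. recurrent_path (pos V))"
  shows "0 < escape_prob"
proof -
  obtain N where N_bounds: "0 < iid_unif.prob {V. \<forall>j. cross_count (arrow V) j 0 \<le> N}"
    using bounded_cross_count_if_transient[OF assms] .
  let ?up = "\<lambda>V. \<forall>i<Suc N. arrow V 1 i = True"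
  let ?few = "\<lambda>V. \<forall>j. cross_count (arrow V) j 1 \<le> N"
  have "0 < iid_unif.prob {V. ?up V} * iid_unif.prob {V. ?few V}"
    using N_bounds prob_arrow_pattern_pos[of "Suc N" 1 "\<lambda>_. True"]
      prob_cross_count_shift[of 1 "\<lambda>c. \<forall>j. c j \<le> N"] by simp
  also have "\<dots> = iid_unif.prob {V. ?up V \<and> ?few V}"
    by (rule prob_iid_unif_indep[symmetric, OF _ _ depends_on_compose[OF depends_on_arrow]
          depends_on_compose[OF depends_on_cross_counts]]) auto
  also have "\<dots> \<le> escape_prob"
    unfolding escape_prob_def
  proof (rule iid_unif.finite_measure_mono)
    show "{V. ?up V \<and> ?few V} \<subseteq> {V. never_crossed_back (arrow V) 0}"
    proof safe
      fix V assume up: "?up V" and few: "?few V"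
      have "cross_count (arrow V) j 0 = 0" for j
      proof (cases j)
        case (Suc i)
        have "arrow V 1 i'" if "i' \<le> cross_count (arrow V) i 1" for i'
          using up few that by (meson le_trans less_Suc_eq_le)
        then show ?thesis
          by (simp add: Suc downs_before_up_eq_0)
      qed simp
      then show "never_crossed_back (arrow V) 0"
        by (simp add: never_crossed_back_def)
    qed
  qed measurable
  finally show ?thesis .
qed

lemma reach_prob_decseq: "decseq reach_prob"
proof (rule decseq_SucI)
  show "reach_prob (Suc m) \<le> reach_prob m" for m
    unfolding reach_prob_def
  proof (rule iid_unif.finite_measure_mono_AE, use AE_right_reaching in eventually_elim)
    case (elim V)
    interpret right_reaching_stack_walk "arrow V" "pos V" by fact
    show ?case
      using cross_count_mono[of m] by (auto simp: direct_to_def)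
  qed measurable
qed

lemma reach_prob_ge: "iid_unif.prob {V. arrow V 0 0} * escape_prob \<le> reach_prob m"
proof -
  have "iid_unif.prob {V. arrow V 0 0} * escape_prob =
      iid_unif.prob {V. arrow V 0 0 \<and> never_crossed_back (arrow V) 0}"
    unfolding escape_prob_def
    by (rule prob_iid_unif_indep[symmetric, OF _ _ depends_on_compose[OF depends_on_arrow]
          depends_on_never_crossed_back]) auto
  also have "\<dots> \<le> reach_prob m"
    unfolding reach_prob_def
    by (intro iid_unif.finite_measure_mono) (auto simp: direct_to_def never_crossed_back_def)
  finally show ?thesis .
qed

lemma nn_integral_total_drift_if_direct_to:
  "(\<integral>\<^sup>+V. of_bool (direct_to (arrow V) m) * total_drift V (int (Suc m)) \<partial>iid_unif) =
   ennreal (reach_prob m) * mean_drift"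
proof -
  have "(\<integral>\<^sup>+V. total_drift V (int (Suc m)) \<partial>iid_unif) = mean_drift"
    using nn_integral_drift_shift[of "int (Suc m)" "\<lambda>_ d. \<Sum>i. ennreal (d i)"]
    by (simp add: mean_drift_def total_drift_def)
  then show ?thesis
    by (subst nn_integral_iid_unif_indep[OF _ _ depends_on_compose[OF depends_on_direct_to]
            depends_on_total_drift])
       (auto simp: iid_unif.nn_integral_of_bool reach_prob_def)
qed

lemma nn_integral_later_drift_if_direct_to:
  fixes m :: nat
  defines "x \<equiv> int (Suc m)"
  shows "(\<integral>\<^sup>+V. of_bool (direct_to (arrow V) m) *
      (of_bool (arrow V x 0) * later_drift V x * of_bool (never_crossed_back (arrow V) x)) \<partial>iid_unif) =
    ennreal (reach_prob m) * (mean_later_drift * ennreal escape_prob)"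
proof -
  let ?later = "\<lambda>V. of_bool (arrow V x 0) * later_drift V x :: ennreal"
  let ?escape = "\<lambda>V. of_bool (never_crossed_back (arrow V) x) :: ennreal"
  have later: "depends_on ({x} \<times> UNIV) ?later"
    by (rule depends_on_compose2[OF depends_on_arrow depends_on_later_drift])
  have escape: "depends_on ({x<..} \<times> UNIV) ?escape"
    by (rule depends_on_compose[OF depends_on_never_crossed_back])
  have "(\<integral>\<^sup>+V. ?later V \<partial>iid_unif) = mean_later_drift"
    using nn_integral_drift_shift[of x "\<lambda>a d. of_bool (a 0) * (\<Sum>i. ennreal (d (Suc i)))"]
    by (simp add: mean_later_drift_def later_drift_def x_def)
  moreover have "(\<integral>\<^sup>+V. ?escape V \<partial>iid_unif) = ennreal escape_prob"
    by (simp add: iid_unif.nn_integral_of_bool prob_never_crossed_back x_def)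
  ultimately have later_escape: "(\<integral>\<^sup>+V. ?later V * ?escape V \<partial>iid_unif) = mean_later_drift * ennreal escape_prob"
    by (subst nn_integral_iid_unif_indep[OF _ _ later escape]) auto
  have "depends_on ({x..} \<times> UNIV) (\<lambda>V. ?later V * ?escape V)"
    by (rule depends_on_compose2[OF depends_on_mono[OF later] depends_on_mono[OF escape]]) auto
  then show ?thesis
    using later_escape
    by (subst nn_integral_iid_unif_indep[OF _ _ depends_on_compose[OF depends_on_direct_to]])
       (auto simp: iid_unif.nn_integral_of_bool reach_prob_def x_def)
qed

lemma integrable_site_weight: "integrable iid_unif (\<lambda>V. site_weight (drift V) (pos V) G n x)"
proof -
  let ?g = "\<lambda>xs. of_bool (set (tl xs) \<subseteq> G \<and> last xs = x) * (2 * up_prob xs - 1)"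
  have as_path: "site_weight (drift V) (pos V) G n x = (\<Sum>i<n. ?g (path V i))" for V
    unfolding site_weight_def
    by (intro sum.cong)
       (auto simp: stack_driven.stays_in_pos_iff up_prob_path drift_def simp flip: stack_driven.pos_def)
  show ?thesis
    unfolding as_path by (intro Bochner_Integration.integrable_sum stack_driven.integrable_path[of ?g])
qed

lemma nn_integral_site_weight_le:
  assumes "G \<subseteq> {0<..}"
  shows "(\<integral>\<^sup>+V. ennreal (site_weight (drift V) (pos V) G n (int (Suc m))) \<partial>iid_unif) +
      ennreal (reach_prob m) * (mean_later_drift * ennreal escape_prob)
    \<le> ennreal (reach_prob m) * mean_drift"
proof -
  let ?x = "int (Suc m)"
  let ?w = "\<lambda>V. ennreal (site_weight (drift V) (pos V) G n ?x)"
  let ?unused = "\<lambda>V. of_bool (direct_to (arrow V) m) *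
      (of_bool (arrow V ?x 0) * later_drift V ?x * of_bool (never_crossed_back (arrow V) ?x)) :: ennreal"
  have [measurable]: "?w \<in> borel_measurable iid_unif"
    using borel_measurable_integrable[OF integrable_site_weight] by measurable
  have "(\<integral>\<^sup>+V. ?w V \<partial>iid_unif) + (\<integral>\<^sup>+V. ?unused V \<partial>iid_unif) = (\<integral>\<^sup>+V. ?w V + ?unused V \<partial>iid_unif)"
    by (rule nn_integral_add[symmetric]) measurable
  also have "\<dots> \<le> (\<integral>\<^sup>+V. of_bool (direct_to (arrow V) m) * total_drift V ?x \<partial>iid_unif)"
    by (rule nn_integral_mono_AE, use AE_right_reaching in eventually_elim)
       (rule site_weight_plus_later_drift_le[OF _ assms])
  finally show ?thesis
    unfolding nn_integral_later_drift_if_direct_to nn_integral_total_drift_if_direct_to .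
qed

lemma integral_site_weight_le:
  assumes "mean_drift \<le> 1" "G \<subseteq> {0<..}"
  shows "(\<integral>V. site_weight (drift V) (pos V) G n (int (Suc m)) \<partial>iid_unif) \<le> reach_prob m * net_drift"
proof -
  define w where "w = (\<integral>V. site_weight (drift V) (pos V) G n (int (Suc m)) \<partial>iid_unif)"
  obtain g where mean_drift_g: "mean_drift = ennreal g" "0 \<le> g"
    using assms(1) by (cases mean_drift) (auto simp: top_unique)
  obtain h where mean_later_drift_h: "mean_later_drift = ennreal h" "0 \<le> h"
    using mean_later_drift_le mean_drift_g(1) by (cases mean_later_drift) (auto simp: top_unique)
  have prob_nonneg: "0 \<le> reach_prob m" "0 \<le> escape_prob"
    by (simp_all add: reach_prob_def escape_prob_def)
  have w_nonneg: "0 \<le> w"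
    unfolding w_def by (intro integral_nonneg_AE AE_I2 site_weight_nonneg drift_nonneg)
  have "(\<integral>\<^sup>+V. ennreal (site_weight (drift V) (pos V) G n (int (Suc m))) \<partial>iid_unif) = ennreal w"
    unfolding w_def by (intro nn_integral_eq_integral integrable_site_weight AE_I2 site_weight_nonneg drift_nonneg)
  with nn_integral_site_weight_le[OF assms(2), of n m]
  have "ennreal (w + reach_prob m * (h * escape_prob)) \<le> ennreal (reach_prob m * g)"
    using prob_nonneg w_nonneg mean_drift_g(2) mean_later_drift_h(2) by (simp add: mean_drift_g(1) mean_later_drift_h(1) flip: ennreal_mult ennreal_plus)
  then have "w + reach_prob m * (h * escape_prob) \<le> reach_prob m * g"
    using prob_nonneg(1) mean_drift_g(2) by (subst (asm) ennreal_le_iff) auto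
  then show ?thesis
    using mean_drift_g mean_later_drift_h by (simp add: w_def net_drift_def algebra_simps)
qed

lemma integral_exit_gain_excursion_le:
  assumes "mean_drift \<le> 1"
  shows "(\<integral>V. exit_gain (pos V) {0<..<int (Suc j)} n \<partial>iid_unif) \<le> 1 + net_drift * (\<Sum>m<j. reach_prob m)"
proof -
  let ?G = "{0<..<int (Suc j)}"
  let ?w = "\<lambda>V x. site_weight (drift V) (pos V) ?G n x"
  let ?sites = "(\<lambda>m. int (Suc m)) ` {..<j}"
  have "x \<in> ?sites" if "x \<in> ?G" for x
    using that by (intro image_eqI[of _ _ "nat (x - 1)"]) auto
  then have "stack_driven.exit_drift V ?G n = (\<Sum>x\<in>insert 0 ?sites. ?w V x)" for V
    by (intro exit_drift_eq_sum_site_weight) auto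
  also have "(\<Sum>x\<in>insert 0 ?sites. ?w V x) = ?w V 0 + (\<Sum>m<j. ?w V (int (Suc m)))" for V
    by (subst sum.insert) (auto simp: sum.reindex inj_on_def)
  finally have "(\<integral>V. exit_gain (pos V) ?G n \<partial>iid_unif) =
      (\<integral>V. ?w V 0 \<partial>iid_unif) + (\<Sum>m<j. \<integral>V. ?w V (int (Suc m)) \<partial>iid_unif)"
    by (simp add: stack_driven.integral_exit_gain integrable_site_weight del: of_nat_Suc)
  also have "(\<integral>V. ?w V 0 \<partial>iid_unif) \<le> (\<integral>V. 1 \<partial>(iid_unif :: (int \<times> nat \<Rightarrow> real) measure))"
  proof (intro integral_mono integrable_site_weight)
    fix V
    have "?w V 0 \<le> drift V 0 0"
      by (rule site_weight_outside_le) (auto simp: drift_nonneg)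
    then show "?w V 0 \<le> 1"
      using drift_less_1[of V 0 0] by linarith
  qed simp
  also have "(\<Sum>m<j. \<integral>V. ?w V (int (Suc m)) \<partial>iid_unif) \<le> (\<Sum>m<j. reach_prob m * net_drift)"
    by (intro sum_mono integral_site_weight_le assms) auto
  finally show ?thesis
    by (simp add: sum_distrib_left mult.commute)
qed

lemma prob_reach_before_tendsto:
  "(\<lambda>n. iid_unif.prob {V. direct_to (arrow V) j \<and> (\<exists>i\<le>n. pos V i = int (Suc j))}) \<longlonglongrightarrow> reach_prob j"
  unfolding reach_prob_def
proof (rule iid_unif.measure_tendsto_if_AE_eventually)
  show "AE V in iid_unif. \<forall>\<^sub>F n in sequentially.
      V \<in> {V. direct_to (arrow V) j \<and> (\<exists>i\<le>n. pos V i = int (Suc j))} \<longleftrightarrow> V \<in> {V. direct_to (arrow V) j}"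
    using AE_right_reaching
  proof eventually_elim
    case (elim V)
    interpret right_reaching_stack_walk "arrow V" "pos V" by fact
    obtain i where "pos V i = int (Suc j)"
      using hits[of "int (Suc j)"] by auto
    then show ?case
      by (intro eventually_sequentiallyI[of i]) auto
  qed
qed measurable

lemma reach_prob_recursion:
  assumes "mean_drift \<le> 1"
  shows "real (Suc j) * reach_prob j \<le> 2 + net_drift * (\<Sum>m<j. reach_prob m)"
proof (rule LIMSEQ_le_const2)
  define Q where "Q n = {V. direct_to (arrow V) j \<and> (\<exists>i\<le>n. pos V i = int (Suc j))}" for n
  have [measurable]: "Q n \<in> sets iid_unif" for n
    unfolding Q_def by measurable
  show "(\<lambda>n. real (Suc j) * iid_unif.prob (Q n)) \<longlonglongrightarrow> real (Suc j) * reach_prob j"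
    unfolding Q_def by (intro tendsto_mult tendsto_const prob_reach_before_tendsto)
  have "real (Suc j) * iid_unif.prob (Q n) \<le> 2 + net_drift * (\<Sum>m<j. reach_prob m)" for n
  proof -
    have "real (Suc j) * iid_unif.prob (Q n) - 1 = (\<integral>V. real (Suc j) * indicator (Q n) V - 1 \<partial>iid_unif)"
      by (simp add: iid_unif.emeasure_eq_measure)
    also have "\<dots> \<le> (\<integral>V. exit_gain (pos V) {0<..<int (Suc j)} n \<partial>iid_unif)"
    proof (rule integral_mono)
      fix V
      show "real (Suc j) * indicator (Q n) V - 1 \<le> exit_gain (pos V) {0<..<int (Suc j)} n"
        using exit_gain_excursion_ge[of V "int (Suc j)" n] exit_gain_excursion_direct[of V j _ n]
        by (cases "V \<in> Q n") (auto simp: Q_def)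
    qed (use stack_driven.integrable_exit_gain in \<open>simp_all add: iid_unif.emeasure_eq_measure\<close>)
    also have "\<dots> \<le> 1 + net_drift * (\<Sum>m<j. reach_prob m)"
      by (rule integral_exit_gain_excursion_le[OF assms])
    finally show ?thesis by simp
  qed
  then show "\<exists>N. \<forall>n\<ge>N. real (Suc j) * iid_unif.prob (Q n) \<le> 2 + net_drift * (\<Sum>m<j. reach_prob m)"
    by blast
qed

lemma net_drift_less_1:
  assumes "mean_drift \<le> 1" "0 < escape_prob"
  shows "net_drift < 1"
proof (cases "mean_drift = 0")
  case True
  then show ?thesis
    using mean_later_drift_le by (simp add: net_drift_def)
next
  case False
  have "mean_later_drift < top"
    using mean_later_drift_le assms(1) by (meson ennreal_one_less_top le_less_trans)
  then have "0 < enn2real mean_later_drift * escape_prob"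
    using mean_later_drift_pos False assms(2) by (simp add: enn2real_positive_iff zero_less_iff_neq_zero)
  moreover have "enn2real mean_drift \<le> 1"
    using assms(1) by (metis enn2real_1 enn2real_mono ennreal_one_less_top)
  ultimately show ?thesis
    by (simp add: net_drift_def)
qed

lemma reach_prob_limit:
  assumes "0 < escape_prob"
  obtains L where "reach_prob \<longlonglongrightarrow> L" "0 < L"
proof -
  have "0 \<le> reach_prob j" for j
    by (simp add: reach_prob_def)
  then obtain L where L_limit: "reach_prob \<longlonglongrightarrow> L"
    using decseq_convergent[OF reach_prob_decseq, of 0] by blast
  have "0 < iid_unif.prob {V. arrow V 0 0} * escape_prob"
    using assms prob_arrow_pattern_pos[of 1 0 "\<lambda>_. True"] by simp
  also have "\<dots> \<le> L"
    using reach_prob_ge by (intro LIMSEQ_le_const[OF L_limit]) auto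
  finally show ?thesis
    using that[OF L_limit] by simp
qed

lemma recurrent_if_mean_drift_le_1:
  assumes "mean_drift \<le> 1"
  shows "AE V in iid_unif. recurrent_path (pos V)"
proof (rule ccontr)
  assume "\<not> ?thesis"
  then have escape: "0 < escape_prob"
    by (rule escape_prob_pos)
  then obtain L where L_limit: "reach_prob \<longlonglongrightarrow> L" "0 < L"
    by (rule reach_prob_limit)
  have "(\<lambda>j. 2 / real j + net_drift * ((\<Sum>m<j. reach_prob m) / real j)) \<longlonglongrightarrow> 0 + net_drift * L"
    by (intro tendsto_add tendsto_mult tendsto_const cesaro_mean_tendsto L_limit(1) lim_const_over_n)
  moreover have "reach_prob j \<le> 2 / real j + net_drift * ((\<Sum>m<j. reach_prob m) / real j)" if "1 \<le> j" for j
  proof -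
    have "0 \<le> reach_prob j"
      by (simp add: reach_prob_def)
    then have "real j * reach_prob j \<le> 2 + net_drift * (\<Sum>m<j. reach_prob m)"
      using reach_prob_recursion[OF assms, of j] by (simp add: algebra_simps)
    then show ?thesis
      using that by (simp add: field_simps)
  qed
  ultimately have "L \<le> 0 + net_drift * L"
    by (intro LIMSEQ_le[OF L_limit(1)]) auto
  moreover have "net_drift * L < 1 * L"
    using net_drift_less_1[OF assms escape] L_limit(2) by (rule mult_strict_right_mono)
  ultimately show False by simp
qed

lemma mean_drift_eq_urn:
  "mean_drift = (\<integral>\<^sup>+U. (\<Sum>k. ennreal (2 * f (urn_alpha f (a0 1) (l0 1) U k) - 1)) \<partial>unif_seq)"
proof -
  let ?urn_drift = "\<lambda>U. \<Sum>k. ennreal (2 * f (urn_alpha f (a0 1) (l0 1) U k) - 1)"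
  have total_drift_eq: "total_drift V 1 = ?urn_drift (V \<circ> Pair 1)" for V
    by (simp add: total_drift_def drift_def stack_alpha_def comp_def)
  have "(\<lambda>U. U \<circ> snd) \<in> measurable iid_unif (iid_unif :: (int \<times> nat \<Rightarrow> real) measure)"
    by (rule measurable_iid_unifI) simp
  from measurable_compose[OF this total_drift_measurable[of 1]]
  have "?urn_drift \<in> borel_measurable iid_unif"
    by (simp add: total_drift_eq comp_def)
  moreover have "inj (Pair (1 :: int))"
    by (simp add: inj_def)
  ultimately show ?thesis
    unfolding mean_drift_def total_drift_eq unif_seq_eq_iid_unif by (intro nn_integral_iid_unif_reindex)
qed

end

theorem theorem1:
  fixes f :: "real \<Rightarrow> real" and a0 l0 :: "int \<Rightarrow> real"
  assumes "C3_on_unit f"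
    and "\<forall>x\<in>{0..1}. 0 < f x \<and> f x < 1"
    and "isolated_fixed_points f"
    and "\<forall>x\<in>{0..1}. f x \<ge> 1/2"
    and "\<forall>x. 0 \<le> a0 x \<and> a0 x \<le> 1 \<and> 0 < l0 x"
    and "\<forall>x\<ge>1. a0 x = a0 1 \<and> l0 x = l0 1"
  shows "(AE U in unif_seq. recurrent_path (grrw f a0 l0 U))
     \<longleftrightarrow> (\<integral>\<^sup>+ U. (\<Sum>k. ennreal (2 * f (urn_alpha f (a0 1) (l0 1) U k) - 1)) \<partial>unif_seq) \<le> 1"
proof -
  obtain f1 where "\<forall>x\<in>{0..1}. (f has_real_derivative f1 x) (at x within {0..1})"
    using assms(1) unfolding C3_on_unit_def by blast
  then have "continuous_on {0..1} f"
    by (intro DERIV_continuous_on) auto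
  then interpret homogeneous_grrw f a0 l0
    using assms(2,4-6) by unfold_locales blast+
  show ?thesis
    unfolding AE_recurrent_grrw_iff mean_drift_eq_urn[symmetric]
    using mean_drift_le_1_if_recurrent recurrent_if_mean_drift_le_1 by blast
qed

end
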